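(* As $H\to\infty$, $N_{V_4}(H)+N_{C_4}(H)\ll H^2\log H$.
   Context: Let $\mathcal S_H$ be the set of monic quartic polynomials $X^4+aX^3+bX^2+cX+d$ with $a,b,c,d\in\mathbb Z\cap[-H,H]$ that are irreducible over $\mathbb Q$. For a group $G$, $N_G(H)=\#\{f\in\mathcal S_H: G_f\simeq G\}$, where $G_f$ is the Galois group of $f$ over $\mathbb Q$. $V_4$ is the Klein four group and $C_4$ the cyclic group of order 4. *)

theory Defs
  imports Complex_Main "HOL-Algebra.Elementary_Groups"
    "HOL-Computational_Algebra.Polynomial" "HOL-Library.Landau_Symbols"
begin

definition is_subfield :: "complex set \<Rightarrow> bool" where
  "is_subfield S \<longleftrightarrow> 0 \<in> S \<and> 1 \<in> S \<and>
     (\<forall>x\<in>S. \<forall>y\<in>S. x + y \<in> S \<and> x - y \<in> S \<and> x * y \<in> S) \<and>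
     (\<forall>x\<in>S. x \<noteq> 0 \<longrightarrow> inverse x \<in> S)"

definition croots :: "int poly \<Rightarrow> complex set" where
  "croots f = {z. poly (map_poly of_int f) z = 0}"

definition splitting_field :: "int poly \<Rightarrow> complex set" where
  "splitting_field f = \<Inter>{S. is_subfield S \<and> croots f \<subseteq> S}"

text \<open>Field automorphisms of the splitting field (these automatically fix Q).\<close>
definition field_auts :: "complex set \<Rightarrow> (complex \<Rightarrow> complex) set" where
  "field_auts K = {\<sigma>. \<sigma> \<in> extensional K \<and> bij_betw \<sigma> K K \<and> \<sigma> 1 = 1 \<and>
      (\<forall>x\<in>K. \<forall>y\<in>K. \<sigma> (x + y) = \<sigma> x + \<sigma> y \<and> \<sigma> (x * y) = \<sigma> x * \<sigma> y)}"

definition galois_group :: "int poly \<Rightarrow> (complex \<Rightarrow> complex) monoid" where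
  "galois_group f =
     \<lparr>carrier = field_auts (splitting_field f),
      monoid.mult = (\<lambda>\<sigma> \<tau>. compose (splitting_field f) \<sigma> \<tau>),
      monoid.one = restrict id (splitting_field f)\<rparr>"

definition quartic :: "int \<Rightarrow> int \<Rightarrow> int \<Rightarrow> int \<Rightarrow> int poly" where
  "quartic a b c d = [:d, c, b, a, 1:]"

text \<open>S_H, as coefficient tuples (distinct tuples give distinct polynomials).\<close>
definition S_H :: "nat \<Rightarrow> (int \<times> int \<times> int \<times> int) set" where
  "S_H H = {(a, b, c, d). \<bar>a\<bar> \<le> int H \<and> \<bar>b\<bar> \<le> int H \<and> \<bar>c\<bar> \<le> int H \<and> \<bar>d\<bar> \<le> int H \<and>
            irreducible (map_poly (of_int :: int \<Rightarrow> rat) (quartic a b c d))}"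

definition N_G :: "'g monoid \<Rightarrow> nat \<Rightarrow> nat" where
  "N_G G H = card {(a, b, c, d) \<in> S_H H. galois_group (quartic a b c d) \<cong> G}"

definition C4 :: "int monoid" where "C4 = integer_mod_group 4"
definition V4 :: "(int \<times> int) monoid" where
  "V4 = integer_mod_group 2 \<times>\<times> integer_mod_group 2"

end

theory Submission
  imports "Berlekamp_Zassenhaus.Mahler_Measure" "HOL-Analysis.Harmonic_Numbers"
    "HOL-Real_Asymp.Real_Asymp" "HOL-Computational_Algebra.Squarefree" Defs
begin

text \<open>
  If the Galois group of \<open>f\<close> is \<open>V\<^sub>4\<close> or \<open>C\<^sub>4\<close>, the roots can be numbered such that
  \<open>x = r\<^sub>1 r\<^sub>2 + r\<^sub>3 r\<^sub>4\<close> is an integer. The squares and the product of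
  \<open>\<theta> = r\<^sub>1 + r\<^sub>2 - r\<^sub>3 - r\<^sub>4\<close> and \<open>\<phi> = r\<^sub>1 r\<^sub>2 - r\<^sub>3 r\<^sub>4\<close> are then integers, so that
  \<open>\<theta> = w \<surd>u\<close> and \<open>\<phi> = v \<surd>u\<close> with \<open>u\<close> squarefree unless \<open>\<theta> = 0\<close>, and \<open>(u, w, v, a, x)\<close> determines \<open>f\<close>.
  Landau's inequality bounds the product of the \<open>t\<^sub>i = max 1 \<bar>r\<^sub>i\<bar>\<close> by \<open>3 H\<close>, while
  \<open>\<theta>\<close>, \<open>\<phi>\<close>, \<open>a + \<theta> = - 2 (r\<^sub>3 + r\<^sub>4)\<close> and \<open>x - \<phi> = 2 r\<^sub>3 r\<^sub>4\<close> have size at most about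
  \<open>max t\<^sub>i\<close>, \<open>t\<^sub>1 t\<^sub>2\<close>, \<open>max t\<^sub>3 t\<^sub>4\<close> and \<open>t\<^sub>3 t\<^sub>4\<close>. Hence for fixed \<open>u\<close> and fixed dyadic sizes there are
  \<open>O(H\<^sup>2 / \<bar>u\<bar>)\<close> polynomials, and the sum over \<open>u\<close> costs one logarithm. A second logarithm from the
  dyadic sum is avoided in two different ways. For \<open>V\<^sub>4\<close> every numbering of the roots is admissible, and
  pairing the two largest roots gains a factor \<open>1 / (t\<^sub>3 t\<^sub>4)\<close>. For \<open>C\<^sub>4\<close> the number \<open>x\<close> also satisfies
  \<open>a\<^sup>2 \<equiv> 8 x (mod u)\<close>, which thins out its range. Polynomials with \<open>\<theta> = 0\<close> satisfy
  \<open>8 c = a (4 b - a\<^sup>2)\<close>, and they are counted directly.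
\<close>

section \<open>Extending homomorphisms between subfields of the complex numbers\<close>

definition polys_over :: "complex set \<Rightarrow> complex poly set" where
  "polys_over F = {p. \<forall>i. coeff p i \<in> F}"

definition hom_on :: "complex set \<Rightarrow> (complex \<Rightarrow> complex) \<Rightarrow> bool" where
  "hom_on F \<phi> \<longleftrightarrow> \<phi> 1 = 1 \<and> (\<forall>x\<in>F. \<forall>y\<in>F. \<phi> (x + y) = \<phi> x + \<phi> y \<and> \<phi> (x * y) = \<phi> x * \<phi> y)"

locale complex_subfield =
  fixes F :: "complex set"
  assumes subfield: "is_subfield F"
begin

lemma zero_closed [simp]: "0 \<in> F" and one_closed [simp]: "1 \<in> F"
  using subfield by (auto simp: is_subfield_def)

lemma add_closed: "x \<in> F \<Longrightarrow> y \<in> F \<Longrightarrow> x + y \<in> F"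
  and diff_closed: "x \<in> F \<Longrightarrow> y \<in> F \<Longrightarrow> x - y \<in> F"
  and mult_closed: "x \<in> F \<Longrightarrow> y \<in> F \<Longrightarrow> x * y \<in> F"
  using subfield by (auto simp: is_subfield_def)

lemma inverse_closed: "x \<in> F \<Longrightarrow> inverse x \<in> F"
  using subfield by (cases "x = 0") (auto simp: is_subfield_def)

lemma divide_closed: "x \<in> F \<Longrightarrow> y \<in> F \<Longrightarrow> x / y \<in> F"
  by (simp add: divide_inverse mult_closed inverse_closed)

lemma uminus_closed: "x \<in> F \<Longrightarrow> - x \<in> F"
  using diff_closed[of 0 x] by simp

lemma sum_closed: "(\<And>i. i \<in> I \<Longrightarrow> g i \<in> F) \<Longrightarrow> sum g I \<in> F"
  by (induction I rule: infinite_finite_induct) (auto intro: add_closed)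

lemma power_closed: "x \<in> F \<Longrightarrow> x ^ n \<in> F"
  by (induction n) (auto intro: mult_closed)

lemma of_nat_closed: "of_nat n \<in> F"
  by (induction n) (auto intro: add_closed)

lemma of_int_closed: "of_int n \<in> F"
  by (cases n) (auto intro: of_nat_closed uminus_closed simp del: of_nat_Suc)

lemmas closed = add_closed diff_closed mult_closed inverse_closed divide_closed uminus_closed
  power_closed of_int_closed

section \<open>Division, ideals and minimal polynomials over a subfield\<close>

lemma polys_over_closed:
  "0 \<in> polys_over F" "1 \<in> polys_over F"
  "p \<in> polys_over F \<Longrightarrow> q \<in> polys_over F \<Longrightarrow> p + q \<in> polys_over F"
  "p \<in> polys_over F \<Longrightarrow> q \<in> polys_over F \<Longrightarrow> p - q \<in> polys_over F"
  "p \<in> polys_over F \<Longrightarrow> q \<in> polys_over F \<Longrightarrow> p * q \<in> polys_over F"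
  "c \<in> F \<Longrightarrow> [:c:] \<in> polys_over F"
  "c \<in> F \<Longrightarrow> monom c n \<in> polys_over F"
  "c \<in> F \<Longrightarrow> p \<in> polys_over F \<Longrightarrow> smult c p \<in> polys_over F"
  by (auto simp: polys_over_def coeff_mult coeff_pCons coeff_1 split: nat.split
      intro!: closed sum_closed)

text \<open>Long division by a monic polynomial never divides coefficients, so quotient and
  remainder stay over \<open>F\<close>; each round cancels the leading term with a monomial multiple
  of \<open>m\<close>.\<close>

lemma polys_over_division:
  assumes m: "m \<in> polys_over F" "lead_coeff m = 1" and p: "p \<in> polys_over F"
  shows "\<exists>q\<in>polys_over F. \<exists>r\<in>polys_over F. p = q * m + r \<and> (r = 0 \<or> degree r < degree m)"
  using p
\<comment> \<open>The measure puts \<open>0\<close> strictly below the nonzero constants, which have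
  the same \<open>degree\<close>; this covers a constant dividend that cancels to
  \<open>0\<close>.\<close>
proof (induction "if p = 0 then 0 else Suc (degree p)" arbitrary: p rule: less_induct)
  case less
  show ?case
  proof (cases "p = 0 \<or> degree p < degree m")
    case True
    then show ?thesis using less.prems polys_over_closed(1)
      by (intro bexI[of _ 0] bexI[of _ p]) auto
  next
    case False
    then have p0: "p \<noteq> 0" and deg: "degree m \<le> degree p" by auto
    have m0: "m \<noteq> 0" using m(2) by auto
    define t where "t = monom (lead_coeff p) (degree p - degree m)"
    have t: "t \<in> polys_over F"
      unfolding t_def using less.prems by (intro polys_over_closed) (auto simp: polys_over_def)
    define p' where "p' = p - t * m"
    have p': "p' \<in> polys_over F"
      unfolding p'_def by (intro polys_over_closed t less.prems m)
    have "degree (t * m) = degree p"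
      using p0 m0 deg by (simp add: t_def degree_mult_eq degree_monom_eq monom_eq_0_iff)
    moreover have "coeff p' (degree p) = 0"
      using deg m(2) by (simp add: p'_def t_def coeff_monom_mult)
    ultimately have "p' = 0 \<or> degree p' < degree p"
      unfolding p'_def
      by (metis degree_diff_le le_refl leading_coeff_0_iff le_neq_implies_less)
    then have "(if p' = 0 then 0 else Suc (degree p')) < (if p = 0 then 0 else Suc (degree p))"
      using p0 by auto
    from less.hyps[OF this p'] obtain q r where
      qr: "q \<in> polys_over F" "r \<in> polys_over F" "p' = q * m + r" "r = 0 \<or> degree r < degree m"
      by blast
    have "p = (q + t) * m + r" using qr(3) by (simp add: p'_def algebra_simps)
    with qr t show ?thesis by (intro bexI[of _ "q + t"] bexI[of _ r]) (auto intro: polys_over_closed)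
  qed
qed

text \<open>A nonzero element of least degree in the ideal \<open>I\<close>, made monic, divides
  everything in \<open>I\<close>, because a nonzero remainder would be an element of smaller
  degree.\<close>

lemma polys_over_ideal:
  assumes I: "I \<subseteq> polys_over F" "\<And>p q. p \<in> I \<Longrightarrow> q \<in> I \<Longrightarrow> p - q \<in> I"
      "\<And>p q. p \<in> I \<Longrightarrow> q \<in> polys_over F \<Longrightarrow> q * p \<in> I"
    and ne: "p0 \<in> I" "p0 \<noteq> 0"
  obtains m where "m \<in> I" "lead_coeff m = 1"
    "\<And>p. p \<in> I \<Longrightarrow> \<exists>q\<in>polys_over F. p = q * m"
    "\<And>p. p \<in> I \<Longrightarrow> p \<noteq> 0 \<Longrightarrow> degree m \<le> degree p"
proof -
  obtain m0 where m0: "m0 \<in> I" "m0 \<noteq> 0" "\<And>p. p \<in> I \<and> p \<noteq> 0 \<Longrightarrow> degree m0 \<le> degree p"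
    using ex_has_least_nat[of "\<lambda>p. p \<in> I \<and> p \<noteq> 0" p0 degree] ne by auto
  define m where "m = smult (inverse (lead_coeff m0)) m0"
  have lc: "lead_coeff m0 \<in> F" using m0(1) I(1) by (auto simp: polys_over_def)
  have "m = [:inverse (lead_coeff m0):] * m0" by (simp add: m_def)
  then have mI: "m \<in> I"
    using I(3)[OF m0(1)] polys_over_closed(6)[OF inverse_closed[OF lc]] by metis
  have lcm: "lead_coeff m = 1" using m0(2) by (simp add: m_def)
  have deg: "degree m = degree m0" using m0(2) by (simp add: m_def)
  have "\<exists>q\<in>polys_over F. p = q * m" if p: "p \<in> I" for p
  proof -
    obtain q r where qr: "q \<in> polys_over F" "p = q * m + r" "r = 0 \<or> degree r < degree m"
      using polys_over_division[of m p] mI lcm p I(1) by blast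
    have "p - q * m \<in> I" by (intro I(2) I(3) p mI qr)
    then have "r \<in> I" using qr(2) by simp
    then have "r = 0" using m0(3)[of r] qr(3) deg by force
    with qr show ?thesis by auto
  qed
  with mI lcm m0(3) deg show ?thesis by (intro that[of m]) auto
qed

lemma minimal_polynomial:
  assumes "p0 \<in> polys_over F" "p0 \<noteq> 0" "poly p0 \<alpha> = 0"
  obtains m where "m \<in> polys_over F" "lead_coeff m = 1" "poly m \<alpha> = 0"
    "\<And>p. p \<in> polys_over F \<Longrightarrow> poly p \<alpha> = 0 \<Longrightarrow> \<exists>q\<in>polys_over F. p = q * m"
    "\<And>p. p \<in> polys_over F \<Longrightarrow> poly p \<alpha> = 0 \<Longrightarrow> p \<noteq> 0 \<Longrightarrow> degree m \<le> degree p"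
proof (rule polys_over_ideal[of "{p \<in> polys_over F. poly p \<alpha> = 0}" p0])
  fix m assume "m \<in> {p \<in> polys_over F. poly p \<alpha> = 0}" "lead_coeff m = 1"
    "\<And>p. p \<in> {p \<in> polys_over F. poly p \<alpha> = 0} \<Longrightarrow> \<exists>q\<in>polys_over F. p = q * m"
    "\<And>p. p \<in> {p \<in> polys_over F. poly p \<alpha> = 0} \<Longrightarrow> p \<noteq> 0 \<Longrightarrow> degree m \<le> degree p"
  then show thesis by (intro that[of m]) auto
qed (use assms in \<open>auto intro: polys_over_closed\<close>)

definition adjoin :: "complex \<Rightarrow> complex set" where
  "adjoin \<alpha> = (\<lambda>p. poly p \<alpha>) ` polys_over F"

lemma adjoin_subset: "F \<subseteq> adjoin \<alpha>"
proof
  fix x assume "x \<in> F"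
  then show "x \<in> adjoin \<alpha>"
    unfolding adjoin_def by (intro image_eqI[of _ _ "[:x:]"]) (auto intro: polys_over_closed)
qed

lemma in_adjoin: "\<alpha> \<in> adjoin \<alpha>"
  unfolding adjoin_def
  by (intro image_eqI[of _ _ "monom 1 1"]) (auto intro: polys_over_closed simp: poly_monom)

text \<open>Only inverses need an argument: if \<open>p\<close> does not vanish at \<alpha>, a
  Bezout relation between \<open>p\<close> and the minimal polynomial \<open>m\<close> expresses 1
  as a multiple of \<open>poly p \<alpha>\<close>.\<close>

lemma is_subfield_adjoin:
  assumes "p0 \<in> polys_over F" "p0 \<noteq> 0" "poly p0 \<alpha> = 0"
  shows "is_subfield (adjoin \<alpha>)"
proof -
  have inv: "inverse (poly p \<alpha>) \<in> adjoin \<alpha>" if p: "p \<in> polys_over F" and nz: "poly p \<alpha> \<noteq> 0" for p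
  proof -
    obtain m where m: "m \<in> polys_over F" "lead_coeff m = 1" "poly m \<alpha> = 0"
      "\<And>p. p \<in> polys_over F \<Longrightarrow> poly p \<alpha> = 0 \<Longrightarrow> p \<noteq> 0 \<Longrightarrow> degree m \<le> degree p"
      using minimal_polynomial[OF assms] by metis
    \<comment> \<open>\<open>I\<close> plays the role of the ideal generated by \<open>m\<close> and
      \<open>p\<close>. Its generator \<open>g\<close> does not vanish at \<alpha> because its
      multiple \<open>p\<close> does not; so the cofactor of \<open>g\<close> in \<open>m\<close>
      vanishes there, and minimality of \<open>degree m\<close> makes \<open>g\<close>
      constant.\<close>
    define I where "I = {q \<in> polys_over F. \<exists>s\<in>polys_over F. poly q \<alpha> = poly s \<alpha> * poly p \<alpha>}"
    have mI: "m \<in> I" using m polys_over_closed(1) by (auto simp: I_def intro!: bexI[of _ 0])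
    have pI: "p \<in> I" using p polys_over_closed(2) by (auto simp: I_def intro!: bexI[of _ 1])
    obtain g where g: "g \<in> I" "lead_coeff g = 1" "\<And>p. p \<in> I \<Longrightarrow> \<exists>q\<in>polys_over F. p = q * g"
    proof (rule polys_over_ideal[of I m])
      show "I \<subseteq> polys_over F" by (auto simp: I_def)
      show "q - r \<in> I" if "q \<in> I" "r \<in> I" for q r
        using that by (force simp: I_def algebra_simps intro: polys_over_closed intro!: bexI[of _ "_ - _"])
      show "r * q \<in> I" if "q \<in> I" "r \<in> polys_over F" for q r
        using that by (force simp: I_def algebra_simps intro: polys_over_closed intro!: bexI[of _ "_ * _"])
    qed (use mI m(2) in auto)
    obtain h where h: "h \<in> polys_over F" "m = h * g" using g(3)[OF mI] by auto
    have h0: "h \<noteq> 0" and g0: "g \<noteq> 0" using h(2) m(2) by auto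
    have "poly g \<alpha> \<noteq> 0"
      using g(3)[OF pI] nz by auto
    then have "poly h \<alpha> = 0" using m(3) h(2) by auto
    then have "degree m \<le> degree h" using m(4)[OF h(1)] h0 by auto
    then have "degree g = 0" using h h0 g0 by (simp add: degree_mult_eq)
    then have "g = 1" using g(2) by (metis degree_0_id lead_coeff_1 one_pCons degree_eq_zeroE lead_coeff_pCons(2))
    then obtain s where "s \<in> polys_over F" "1 = poly s \<alpha> * poly p \<alpha>"
      using g(1) by (auto simp: I_def)
    then show ?thesis using nz by (auto simp: adjoin_def field_simps intro!: image_eqI[of _ _ s])
  qed
  show ?thesis
    unfolding is_subfield_def
  proof (intro conjI ballI impI)
    show "0 \<in> adjoin \<alpha>" "1 \<in> adjoin \<alpha>" using adjoin_subset[of \<alpha>] zero_closed one_closed by blast+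
  next
    fix x y assume "x \<in> adjoin \<alpha>" "y \<in> adjoin \<alpha>"
    then obtain p q where "p \<in> polys_over F" "q \<in> polys_over F" "x = poly p \<alpha>" "y = poly q \<alpha>"
      by (auto simp: adjoin_def)
    then show "x + y \<in> adjoin \<alpha>" "x - y \<in> adjoin \<alpha>" "x * y \<in> adjoin \<alpha>"
      using image_eqI[of "x + y" "\<lambda>p. poly p \<alpha>" "p + q"] image_eqI[of "x - y" "\<lambda>p. poly p \<alpha>" "p - q"]
        image_eqI[of "x * y" "\<lambda>p. poly p \<alpha>" "p * q"]
      by (simp_all add: adjoin_def polys_over_closed)
  next
    fix x assume "x \<in> adjoin \<alpha>" "x \<noteq> 0"
    then show "inverse x \<in> adjoin \<alpha>" using inv by (auto simp: adjoin_def)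
  qed
qed

end

section \<open>Homomorphisms of subfields and their extension\<close>

locale subfield_hom = complex_subfield +
  fixes \<phi> :: "complex \<Rightarrow> complex"
  assumes hom: "hom_on F \<phi>"
begin

lemma hom_one [simp]: "\<phi> 1 = 1"
  and hom_add: "x \<in> F \<Longrightarrow> y \<in> F \<Longrightarrow> \<phi> (x + y) = \<phi> x + \<phi> y"
  and hom_mult: "x \<in> F \<Longrightarrow> y \<in> F \<Longrightarrow> \<phi> (x * y) = \<phi> x * \<phi> y"
  using hom by (auto simp: hom_on_def)

lemma hom_zero [simp]: "\<phi> 0 = 0"
  using hom_add[of 0 0] by simp

lemma hom_diff: "x \<in> F \<Longrightarrow> y \<in> F \<Longrightarrow> \<phi> (x - y) = \<phi> x - \<phi> y"
  using hom_add[of "x - y" y] diff_closed by simp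

lemma hom_uminus: "x \<in> F \<Longrightarrow> \<phi> (- x) = - \<phi> x"
  using hom_diff[of 0 x] by simp

lemma hom_sum: "(\<And>i. i \<in> I \<Longrightarrow> g i \<in> F) \<Longrightarrow> \<phi> (sum g I) = (\<Sum>i\<in>I. \<phi> (g i))"
  by (induction I rule: infinite_finite_induct) (auto simp: hom_add sum_closed)

lemma hom_power: "x \<in> F \<Longrightarrow> \<phi> (x ^ n) = \<phi> x ^ n"
  by (induction n) (auto simp: hom_mult power_closed)

lemma hom_of_nat: "\<phi> (of_nat n) = of_nat n"
  by (induction n) (auto simp: hom_add of_nat_closed)

lemma hom_of_int: "\<phi> (of_int n) = of_int n"
  by (cases n) (auto simp: hom_of_nat hom_uminus of_nat_closed simp del: of_nat_Suc)

lemma hom_eq_0_iff: "x \<in> F \<Longrightarrow> \<phi> x = 0 \<longleftrightarrow> x = 0"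
  using hom_mult[of x "inverse x"] inverse_closed[of x] by (cases "x = 0") auto

lemma hom_inverse: "x \<in> F \<Longrightarrow> \<phi> (inverse x) = inverse (\<phi> x)"
  using hom_mult[of x "inverse x"] inverse_closed[of x] hom_eq_0_iff[of x]
  by (cases "x = 0") (auto simp: field_simps)

lemma hom_inj: "inj_on \<phi> F"
  by (rule inj_onI) (metis diff_closed eq_iff_diff_eq_0 hom_diff hom_eq_0_iff)

lemma map_poly_hom:
  assumes "p \<in> polys_over F" "q \<in> polys_over F"
  shows "map_poly \<phi> (p + q) = map_poly \<phi> p + map_poly \<phi> q"
    and "map_poly \<phi> (p - q) = map_poly \<phi> p - map_poly \<phi> q"
    and "map_poly \<phi> (p * q) = map_poly \<phi> p * map_poly \<phi> q"
  using assms
  by (auto intro!: poly_eqI simp: coeff_map_poly polys_over_def hom_add hom_diff coeff_mult hom_sum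
      mult_closed hom_mult)

lemma poly_hom:
  assumes "p \<in> polys_over F" "x \<in> F"
  shows "\<phi> (poly p x) = poly (map_poly \<phi> p) (\<phi> x)"
proof -
  have c: "coeff p i \<in> F" for i using assms by (auto simp: polys_over_def)
  have "poly (map_poly \<phi> p) (\<phi> x) = (\<Sum>i\<le>degree p. coeff (map_poly \<phi> p) i * \<phi> x ^ i)"
    unfolding poly_altdef
  proof (rule sum.mono_neutral_left)
    have "degree (map_poly \<phi> p) \<le> degree p"
      by (rule degree_le) (simp add: coeff_map_poly coeff_eq_0)
    then show "{..degree (map_poly \<phi> p)} \<subseteq> {..degree p}" by auto
  qed (auto simp: coeff_eq_0)
  also have "\<dots> = \<phi> (poly p x)"
    using assms c
    by (simp add: poly_altdef coeff_map_poly hom_sum mult_closed power_closed hom_mult hom_power)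
  finally show ?thesis ..
qed

text \<open>An element of \<open>adjoin \<alpha>\<close> is represented by some polynomial, and its
  image is the value at \<beta> of that polynomial after applying \<phi> to the coefficients;
  \<open>rel\<close> makes this independent of the representative.\<close>

lemma extend_hom_to:
  assumes alg: "p0 \<in> polys_over F" "p0 \<noteq> 0" "poly p0 \<alpha> = 0"
    and rel: "\<And>p. p \<in> polys_over F \<Longrightarrow> poly p \<alpha> = 0 \<Longrightarrow> poly (map_poly \<phi> p) \<beta> = 0"
  obtains \<psi> where "hom_on (adjoin \<alpha>) \<psi>" "\<And>x. x \<in> F \<Longrightarrow> \<psi> x = \<phi> x" "\<psi> \<alpha> = \<beta>"
proof -
  define \<psi> where "\<psi> = (\<lambda>z. poly (map_poly \<phi> (SOME p. p \<in> polys_over F \<and> poly p \<alpha> = z)) \<beta>)"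
  have \<psi>: "\<psi> (poly p \<alpha>) = poly (map_poly \<phi> p) \<beta>" if p: "p \<in> polys_over F" for p
  proof -
    define q where "q = (SOME q. q \<in> polys_over F \<and> poly q \<alpha> = poly p \<alpha>)"
    have q: "q \<in> polys_over F \<and> poly q \<alpha> = poly p \<alpha>"
      unfolding q_def by (rule someI[of _ p]) (use p in auto)
    have "poly (map_poly \<phi> (q - p)) \<beta> = 0"
      by (rule rel) (use p q in \<open>auto intro: polys_over_closed\<close>)
    then show ?thesis using p q by (simp add: \<psi>_def q_def[symmetric] map_poly_hom)
  qed
  have c: "\<psi> x = \<phi> x" if "x \<in> F" for x
  proof -
    have "map_poly \<phi> [:x:] = [:\<phi> x:]"
      by (rule poly_eqI) (simp add: coeff_map_poly coeff_pCons split: nat.split)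
    then show ?thesis using \<psi>[of "[:x:]"] that by (simp add: polys_over_closed)
  qed
  have "\<psi> \<alpha> = \<beta>"
    using \<psi>[of "monom 1 1"] by (simp add: polys_over_closed poly_monom map_poly_monom)
  moreover have "hom_on (adjoin \<alpha>) \<psi>"
    unfolding hom_on_def
  proof (intro conjI ballI)
    show "\<psi> 1 = 1" using c[of 1] by simp
  next
    fix x y assume "x \<in> adjoin \<alpha>" "y \<in> adjoin \<alpha>"
    then obtain p q where "p \<in> polys_over F" "q \<in> polys_over F" "x = poly p \<alpha>" "y = poly q \<alpha>"
      by (auto simp: adjoin_def)
    then show "\<psi> (x + y) = \<psi> x + \<psi> y" "\<psi> (x * y) = \<psi> x * \<psi> y"
      using \<psi>[of p] \<psi>[of q] \<psi>[of "p + q"] \<psi>[of "p * q"]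
      by (simp_all add: polys_over_closed map_poly_hom)
  qed
  ultimately show ?thesis using c that by blast
qed

text \<open>Any root of the \<phi>-image of the minimal polynomial of \<alpha> can serve as the
  image of \<alpha>, and the fundamental theorem of algebra provides one.\<close>

lemma extend_hom:
  assumes alg: "p0 \<in> polys_over F" "p0 \<noteq> 0" "poly p0 \<alpha> = 0"
  obtains \<psi> where "hom_on (adjoin \<alpha>) \<psi>" "\<And>x. x \<in> F \<Longrightarrow> \<psi> x = \<phi> x"
proof -
  obtain m where m: "m \<in> polys_over F" "lead_coeff m = 1" "poly m \<alpha> = 0"
    "\<And>p. p \<in> polys_over F \<Longrightarrow> poly p \<alpha> = 0 \<Longrightarrow> \<exists>q\<in>polys_over F. p = q * m"
    using minimal_polynomial[OF alg] by metis
  have "degree m \<noteq> 0"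
  proof
    assume "degree m = 0"
    then obtain c where "m = [:c:]" by (metis degree_eq_zeroE)
    then show False using m(2,3) by simp
  qed
  \<comment> \<open>The leading coefficient 1 survives \<phi>, so the image polynomial is not
    constant.\<close>
  moreover have "coeff (map_poly \<phi> m) (degree m) = 1" by (simp add: coeff_map_poly m(2))
  then have "degree m \<le> degree (map_poly \<phi> m)" by (intro le_degree) auto
  ultimately have "\<not> constant (poly (map_poly \<phi> m))" by (simp add: constant_degree)
  then obtain \<beta> where \<beta>: "poly (map_poly \<phi> m) \<beta> = 0"
    using fundamental_theorem_of_algebra by blast
  have "poly (map_poly \<phi> p) \<beta> = 0" if "p \<in> polys_over F" "poly p \<alpha> = 0" for p
    using m(4)[OF that] m(1) \<beta> by (auto simp: map_poly_hom)
  then show ?thesis using extend_hom_to[OF alg] that by metis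
qed

end

lemma is_subfield_Rats: "is_subfield \<rat>"
  by (auto simp: is_subfield_def)

lemma is_subfield_Inter: "(\<And>S. S \<in> A \<Longrightarrow> is_subfield S) \<Longrightarrow> is_subfield (\<Inter>A)"
  unfolding is_subfield_def by (intro conjI ballI impI) (auto; fail)+

lemma polys_over_mono: "F \<subseteq> F' \<Longrightarrow> polys_over F \<subseteq> polys_over F'"
  by (auto simp: polys_over_def)

text \<open>The elements are adjoined one at a time; what is algebraic over \<open>F\<close> stays
  algebraic over the larger field.\<close>

lemma extend_hom_finite:
  assumes "finite A" "is_subfield F" "hom_on F \<phi>"
    and "\<And>\<alpha>. \<alpha> \<in> A \<Longrightarrow> \<exists>p\<in>polys_over F. p \<noteq> 0 \<and> poly p \<alpha> = 0"
  shows "\<exists>F' \<psi>. is_subfield F' \<and> F \<union> A \<subseteq> F' \<and> hom_on F' \<psi> \<and> (\<forall>x\<in>F. \<psi> x = \<phi> x)"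
  using assms
proof (induction A arbitrary: F \<phi> rule: finite_induct)
  case empty
  then show ?case by auto
next
  case (insert \<alpha> A)
  interpret subfield_hom F \<phi> using insert.prems by unfold_locales auto
  obtain p where p: "p \<in> polys_over F" "p \<noteq> 0" "poly p \<alpha> = 0" using insert.prems by auto
  obtain \<psi> where \<psi>: "hom_on (adjoin \<alpha>) \<psi>" "\<And>x. x \<in> F \<Longrightarrow> \<psi> x = \<phi> x"
    using extend_hom[OF p] by blast
  have "\<exists>p\<in>polys_over (adjoin \<alpha>). p \<noteq> 0 \<and> poly p \<beta> = 0" if "\<beta> \<in> A" for \<beta>
    using insert.prems(3)[of \<beta>] that polys_over_mono[OF adjoin_subset[of \<alpha>]] by auto
  from insert.IH[OF is_subfield_adjoin[OF p] \<psi>(1) this]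
  obtain F' \<psi>' where "is_subfield F'" "adjoin \<alpha> \<union> A \<subseteq> F'" "hom_on F' \<psi>'"
    "\<forall>x\<in>adjoin \<alpha>. \<psi>' x = \<psi> x"
    by blast
  then show ?case using \<psi>(2) adjoin_subset[of \<alpha>] in_adjoin[of \<alpha>]
    by (intro exI[of _ F'] exI[of _ \<psi>']) auto
qed

section \<open>Automorphisms of the splitting field\<close>

lemma is_subfield_splitting_field: "is_subfield (splitting_field f)"
  unfolding splitting_field_def by (rule is_subfield_Inter) auto

lemma croots_subset_splitting_field: "croots f \<subseteq> splitting_field f"
  unfolding splitting_field_def by auto

lemma splitting_field_subset: "is_subfield L \<Longrightarrow> croots f \<subseteq> L \<Longrightarrow> splitting_field f \<subseteq> L"
  unfolding splitting_field_def by auto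

lemma finite_croots: "f \<noteq> 0 \<Longrightarrow> finite (croots f)"
  unfolding croots_def by (rule poly_roots_finite) auto

lemma int_poly_in_polys_over: "is_subfield F \<Longrightarrow> map_poly of_int f \<in> polys_over F"
  using complex_subfield.of_int_closed[OF complex_subfield.intro]
  by (auto simp: polys_over_def coeff_map_poly)

lemma hom_on_mono: "hom_on L \<psi> \<Longrightarrow> K \<subseteq> L \<Longrightarrow> hom_on K \<psi>"
  by (auto simp: hom_on_def)

text \<open>Integer coefficients are fixed by \<psi>, so roots go to roots, and an injective
  self-map of a finite set is onto.\<close>

lemma hom_croots:
  assumes "is_subfield L" "hom_on L \<psi>" "croots f \<subseteq> L" "f \<noteq> 0"
  shows "\<psi> ` croots f = croots f"
proof -
  interpret subfield_hom L \<psi> using assms by unfold_locales auto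
  have "map_poly \<psi> (map_poly of_int f) = (map_poly of_int f :: complex poly)"
    by (rule poly_eqI) (simp add: coeff_map_poly hom_of_int)
  then have "\<psi> ` croots f \<subseteq> croots f"
    using poly_hom[OF int_poly_in_polys_over[OF assms(1), of f]] assms(3)
    by (force simp: croots_def)
  moreover have "inj_on \<psi> (croots f)" using hom_inj assms(3) by (rule inj_on_subset)
  ultimately show ?thesis using finite_croots[OF assms(4)] by (metis endo_inj_surj)
qed

lemma is_subfield_hom_image:
  assumes "is_subfield L" "hom_on L \<psi>"
  shows "is_subfield (\<psi> ` L)"
proof -
  interpret subfield_hom L \<psi> using assms by unfold_locales auto
  show ?thesis
    unfolding is_subfield_def
  proof (intro conjI ballI impI)
    show "0 \<in> \<psi> ` L" by (rule image_eqI[of _ _ 0]) auto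
    show "1 \<in> \<psi> ` L" by (rule image_eqI[of _ _ 1]) auto
  next
    fix x y assume "x \<in> \<psi> ` L" "y \<in> \<psi> ` L"
    then obtain p q where pq: "p \<in> L" "q \<in> L" "x = \<psi> p" "y = \<psi> q" by auto
    show "x + y \<in> \<psi> ` L"
      by (rule image_eqI[of _ _ "p + q"]) (simp_all add: pq hom_add closed)
    show "x - y \<in> \<psi> ` L"
      by (rule image_eqI[of _ _ "p - q"]) (simp_all add: pq hom_diff closed)
    show "x * y \<in> \<psi> ` L"
      by (rule image_eqI[of _ _ "p * q"]) (simp_all add: pq hom_mult closed)
  next
    fix x assume "x \<in> \<psi> ` L"
    then obtain p where p: "p \<in> L" "x = \<psi> p" by auto
    show "inverse x \<in> \<psi> ` L"
      by (rule image_eqI[of _ _ "inverse p"]) (simp_all add: p hom_inverse closed)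
  qed
qed

lemma is_subfield_hom_vimage:
  assumes "is_subfield L" "hom_on L \<psi>" "is_subfield K"
  shows "is_subfield {x \<in> L. \<psi> x \<in> K}"
proof -
  interpret subfield_hom L \<psi> using assms by unfold_locales auto
  interpret K: complex_subfield K using assms by unfold_locales
  show ?thesis
    unfolding is_subfield_def
    by (auto simp: hom_add hom_diff hom_mult hom_inverse intro: closed K.closed)
qed

text \<open>As \<psi> permutes the roots, both the preimage and the image of the splitting field
  under \<psi> are subfields containing all roots; minimality of the splitting field then gives both
  inclusions.\<close>

lemma hom_restrict_field_auts:
  assumes L: "is_subfield L" "croots f \<subseteq> L" and \<psi>: "hom_on L \<psi>" and f: "f \<noteq> 0"
  shows "restrict \<psi> (splitting_field f) \<in> field_auts (splitting_field f)"
proof -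
  let ?K = "splitting_field f"
  have KL: "?K \<subseteq> L" by (rule splitting_field_subset[OF L])
  have \<psi>K: "hom_on ?K \<psi>" by (rule hom_on_mono[OF \<psi> KL])
  interpret subfield_hom ?K \<psi>
    using \<psi>K is_subfield_splitting_field by unfold_locales auto
  have roots: "\<psi> ` croots f = croots f" by (rule hom_croots[OF L(1) \<psi> L(2) f])
  have "?K \<subseteq> {x \<in> ?K. \<psi> x \<in> ?K}"
    using roots croots_subset_splitting_field
    by (intro splitting_field_subset is_subfield_hom_vimage subfield \<psi>K) auto
  moreover have "?K \<subseteq> \<psi> ` ?K"
    using roots croots_subset_splitting_field
    by (intro splitting_field_subset is_subfield_hom_image subfield \<psi>K) blast
  ultimately have "\<psi> ` ?K = ?K" by auto
  then have "bij_betw \<psi> ?K ?K" using hom_inj by (auto simp: bij_betw_def)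
  then show ?thesis
    by (auto simp: field_auts_def hom_add hom_mult closed)
qed

text \<open>The hypothesis \<open>conjugate\<close> makes the assignment of \<open>z'\<close> to
  \<open>z\<close> well defined on \<open>adjoin z\<close>; the map extends to a field containing
  all roots and restricts to an automorphism.\<close>

lemma ex_field_aut:
  assumes f: "f \<noteq> 0" and z: "z \<in> splitting_field f"
    and alg: "p0 \<in> polys_over \<rat>" "p0 \<noteq> 0" "poly p0 z = 0"
    and conjugate: "\<And>p. p \<in> polys_over \<rat> \<Longrightarrow> poly p z = 0 \<Longrightarrow> poly p z' = 0"
  obtains \<sigma> where "\<sigma> \<in> field_auts (splitting_field f)" "\<sigma> z = z'"
proof -
  interpret complex_subfield \<rat> by unfold_locales (rule is_subfield_Rats)
  have hom: "subfield_hom \<rat> (\<lambda>x. x)"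
    by unfold_locales (auto simp: hom_on_def)
  have id: "map_poly (\<lambda>x. x) p = p" for p :: "complex poly" by (simp add: map_poly_idI)
  obtain \<psi> where \<psi>: "hom_on (adjoin z) \<psi>" "\<psi> z = z'"
    using subfield_hom.extend_hom_to[OF hom alg, of z'] conjugate unfolding id by metis
  have "\<exists>p\<in>polys_over (adjoin z). p \<noteq> 0 \<and> poly p \<alpha> = 0" if "\<alpha> \<in> croots f" for \<alpha>
  proof (intro bexI conjI)
    show "map_poly of_int f \<in> polys_over (adjoin z)"
      by (rule int_poly_in_polys_over[OF is_subfield_adjoin[OF alg]])
    show "map_poly of_int f \<noteq> (0 :: complex poly)" using f by simp
    show "poly (map_poly of_int f) \<alpha> = 0" using that by (simp add: croots_def)
  qed
  from extend_hom_finite[OF finite_croots[OF f] is_subfield_adjoin[OF alg] \<psi>(1) this]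
  obtain L \<psi>' where L: "is_subfield L" "adjoin z \<union> croots f \<subseteq> L" "hom_on L \<psi>'"
    "\<forall>x\<in>adjoin z. \<psi>' x = \<psi> x" by blast
  have "restrict \<psi>' (splitting_field f) \<in> field_auts (splitting_field f)"
    using L f by (intro hom_restrict_field_auts) auto
  moreover have "restrict \<psi>' (splitting_field f) z = z'"
    using z L(4) \<psi>(2) in_adjoin[of z] by simp
  ultimately show ?thesis using that by blast
qed

section \<open>Elements fixed by every automorphism\<close>

lemma pderiv_in_polys_over: "is_subfield F \<Longrightarrow> p \<in> polys_over F \<Longrightarrow> pderiv p \<in> polys_over F"
  using complex_subfield.mult_closed[OF complex_subfield.intro, of F]
    complex_subfield.of_nat_closed[OF complex_subfield.intro, of F]
  by (auto simp: polys_over_def coeff_pderiv simp del: of_nat_Suc)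

text \<open>Every root of the minimal polynomial \<open>m\<close> of \<open>z\<close> is the image
  of \<open>z\<close> under an automorphism, hence equals \<open>z\<close>. As \<open>z\<close> is a
  simple root, \<open>m\<close> is linear and \<open>z\<close> is rational.\<close>

lemma fixed_imp_Rats:
  assumes f: "f \<noteq> 0" and z: "z \<in> splitting_field f"
    and alg: "p0 \<in> polys_over \<rat>" "p0 \<noteq> 0" "poly p0 z = 0"
    and fixed: "\<And>\<sigma>. \<sigma> \<in> field_auts (splitting_field f) \<Longrightarrow> \<sigma> z = z"
  shows "z \<in> \<rat>"
proof -
  interpret complex_subfield \<rat> by unfold_locales (rule is_subfield_Rats)
  obtain m where m: "m \<in> polys_over \<rat>" "lead_coeff m = 1" "poly m z = 0"
    "\<And>p. p \<in> polys_over \<rat> \<Longrightarrow> poly p z = 0 \<Longrightarrow> \<exists>q\<in>polys_over \<rat>. p = q * m"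
    "\<And>p. p \<in> polys_over \<rat> \<Longrightarrow> poly p z = 0 \<Longrightarrow> p \<noteq> 0 \<Longrightarrow> degree m \<le> degree p"
    using minimal_polynomial[OF alg] by metis
  have only: "z' = z" if "poly m z' = 0" for z'
  proof -
    have "poly p z' = 0" if "p \<in> polys_over \<rat>" "poly p z = 0" for p
      using m(4)[OF that] \<open>poly m z' = 0\<close> by auto
    then obtain \<sigma> where "\<sigma> \<in> field_auts (splitting_field f)" "\<sigma> z = z'"
      using ex_field_aut[OF f z alg, of z'] by metis
    then show ?thesis using fixed by auto
  qed
  obtain q where q: "m = [:- z, 1:] * q" using m(3) by (metis dvdE poly_eq_0_iff_dvd)
  have m0: "m \<noteq> 0" using m(2) by auto
  have "degree m \<noteq> 0"
    using m(2,3) by (metis degree_eq_zeroE lead_coeff_pCons(2) poly_const_conv zero_neq_one)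
  then have "pderiv m \<noteq> 0" "degree (pderiv m) < degree m"
    by (auto simp: pderiv_eq_0_iff degree_pderiv)
  \<comment> \<open>In characteristic 0 the derivative is nonzero and of smaller degree than
    \<open>m\<close>, so minimality keeps it from vanishing at \<open>z\<close>.\<close>
  then have "poly (pderiv m) z \<noteq> 0"
    using m(5)[OF pderiv_in_polys_over[OF subfield m(1)]] by force
  then have "poly q z \<noteq> 0" unfolding q pderiv_mult by (auto simp: pderiv_pCons)
  moreover have "poly q z' \<noteq> 0" if "z' \<noteq> z" for z'
    using only[of z'] that by (auto simp: q)
  ultimately have "constant (poly q)" using fundamental_theorem_of_algebra by metis
  then obtain c where "q = [:c:]" by (metis constant_degree degree_eq_zeroE)
  then have "m = [:- z, 1:]" using m(2) q by (cases "c = 0") auto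
  then have "- z \<in> \<rat>" using m(1) by (auto simp: polys_over_def dest: spec[of _ 0])
  then show ?thesis using uminus_closed by force
qed

section \<open>Rational polynomials inside the complex polynomials\<close>

lemma polys_over_Rats_eq: "polys_over \<rat> = range (map_poly of_rat)"
proof (intro equalityI subsetI)
  fix p assume p: "p \<in> polys_over \<rat>"
  define q where "q = map_poly (inv_into UNIV of_rat) p"
  \<comment> \<open>\<open>coeff_map_poly\<close> requires the coefficient map to send 0 to
    0.\<close>
  have inv: "inv_into UNIV of_rat (0::complex) = (0::rat)" using inv_f_f[of of_rat 0] by (simp add: inj_def)
  have "of_rat (inv_into UNIV of_rat (coeff p i)) = coeff p i" for i
    using p by (intro f_inv_into_f) (auto simp: polys_over_def Rats_def)
  then have "p = map_poly of_rat q"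
    by (intro poly_eqI) (simp add: q_def coeff_map_poly inv)
  then show "p \<in> range (map_poly of_rat)" by auto
qed (auto simp: polys_over_def coeff_map_poly)

text \<open>The minimal polynomial \<open>m\<close> of \<open>r\<close> divides \<open>g\<close>
  over the rationals; irreducibility makes the cofactor a unit, so \<open>g\<close> divides whatever
  \<open>m\<close> divides.\<close>

lemma irreducible_dvd_polys_over_Rats:
  assumes g: "irreducible g" "poly (map_poly of_rat g) r = 0"
    and p: "p \<in> polys_over \<rat>" "poly p r = 0"
  shows "map_poly of_rat g dvd (p :: complex poly)"
proof -
  interpret complex_subfield \<rat> by unfold_locales (rule is_subfield_Rats)
  interpret of_rat_poly_hom: map_poly_inj_idom_hom "of_rat :: rat \<Rightarrow> complex" ..
  have gQ: "map_poly of_rat g \<in> polys_over \<rat>" "map_poly of_rat g \<noteq> (0 :: complex poly)"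
    using g by (auto simp: polys_over_Rats_eq)
  obtain m where m: "m \<in> polys_over \<rat>" "lead_coeff m = 1" "poly m r = 0"
    "\<And>p. p \<in> polys_over \<rat> \<Longrightarrow> poly p r = 0 \<Longrightarrow> \<exists>q\<in>polys_over \<rat>. p = q * m"
    using minimal_polynomial[OF gQ g(2)] by metis
  obtain q where q: "q \<in> polys_over \<rat>" "map_poly of_rat g = q * m" using m(4)[OF gQ(1) g(2)] by auto
  obtain q' m' where qm: "q = map_poly of_rat q'" "m = map_poly of_rat m'"
    using q(1) m(1) by (auto simp: polys_over_Rats_eq)
  have "map_poly of_rat g = (map_poly of_rat (q' * m') :: complex poly)"
    using q(2) unfolding qm by (simp add: of_rat_poly_hom.hom_mult)
  then have "g = q' * m'" by simp
  moreover have "\<not> m' dvd 1"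
  proof
    assume "m' dvd 1"
    then have "degree m' = 0" by (simp add: poly_dvd_1)
    then show False
      using m(2,3) unfolding qm by (elim degree_eq_zeroE) (auto simp: map_poly_pCons)
  qed
  ultimately have "q' dvd 1" using irreducibleD[OF g(1)] by blast
  then obtain k where "1 = map_poly of_rat q' * (k :: complex poly)"
    by (elim dvdE) (metis of_rat_poly_hom.hom_mult of_rat_poly_hom.hom_one)
  moreover obtain s where "p = s * m" using m(4)[OF p] by auto
  ultimately have "p = map_poly of_rat g * (k * s)"
    using q(2) qm(1) by (metis mult.assoc mult.commute mult_1)
  then show ?thesis by simp
qed

section \<open>Quartics with Galois group \<open>V\<^sub>4\<close> or \<open>C\<^sub>4\<close>\<close>

definition vieta :: "int \<Rightarrow> int \<Rightarrow> int \<Rightarrow> int \<Rightarrow> complex \<Rightarrow> complex \<Rightarrow> complex \<Rightarrow> complex \<Rightarrow> bool" where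
  "vieta a b c d r1 r2 r3 r4 \<longleftrightarrow>
     of_int a = - (r1 + r2 + r3 + r4) \<and>
     of_int b = r1 * r2 + r1 * r3 + r1 * r4 + r2 * r3 + r2 * r4 + r3 * r4 \<and>
     of_int c = - (r1 * r2 * r3 + r1 * r2 * r4 + r1 * r3 * r4 + r2 * r3 * r4) \<and>
     of_int d = r1 * r2 * r3 * r4"

text \<open>This is the resolvent cubic of the quartic, constant term first. Being monic with
  integer coefficients, it shows that \<open>r1 * r2 + r3 * r4\<close> is an algebraic
  integer.\<close>

lemma resolvent_root:
  assumes "vieta a b c d r1 r2 r3 r4"
  shows "poly [:- (of_int a ^ 2 * of_int d - 4 * of_int b * of_int d + of_int c ^ 2),
    of_int a * of_int c - 4 * of_int d, - of_int b, 1:] (r1 * r2 + r3 * r4) = 0"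
proof -
  note e = assms[unfolded vieta_def]
  show ?thesis
    by (simp add: e[THEN conjunct1] e[THEN conjunct2, THEN conjunct1]
        e[THEN conjunct2, THEN conjunct2, THEN conjunct1] e[THEN conjunct2, THEN conjunct2, THEN conjunct2])
      (simp add: algebra_simps power2_eq_square)
qed

lemma of_int_poly_neq_0: "f \<noteq> 0 \<Longrightarrow> map_poly of_int f \<noteq> (0 :: complex poly)"
  by simp

section \<open>The Galois action on the roots of an irreducible quartic\<close>

locale galois_quartic =
  fixes a b c d :: int
  assumes irred: "irreducible (map_poly (of_int :: int \<Rightarrow> rat) (quartic a b c d))"
begin

abbreviation "f \<equiv> quartic a b c d"
abbreviation "K \<equiv> splitting_field f"
abbreviation "R \<equiv> croots f"
abbreviation "G \<equiv> field_auts K"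

lemma f_nz: "f \<noteq> 0"
  by (simp add: quartic_def)

lemma map_f: "map_poly of_rat (map_poly of_int f) = (map_poly of_int f :: complex poly)"
  by (rule poly_eqI) (simp add: coeff_map_poly)

lemma map_f_eq: "(map_poly of_int f :: complex poly) = [:of_int d, of_int c, of_int b, of_int a, 1:]"
  by (simp add: quartic_def map_poly_pCons)

lemma root_dvd:
  assumes "r \<in> R" "p \<in> polys_over \<rat>" "poly p r = 0"
  shows "map_poly of_int f dvd p"
  using irreducible_dvd_polys_over_Rats[OF irred, of r p] assms by (simp add: map_f croots_def)

text \<open>A multiple root is also a root of the derivative, which would then be divisible by
  \<open>f\<close> in spite of its smaller degree.\<close>

lemma rsquarefree_f: "rsquarefree (map_poly of_int f :: complex poly)"
  unfolding rsquarefree_roots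
proof (intro allI notI)
  fix r assume r: "poly (map_poly of_int f) r = 0 \<and> poly (pderiv (map_poly of_int f)) r = (0 :: complex)"
  have "map_poly of_int f dvd (pderiv (map_poly of_int f) :: complex poly)"
    using r by (intro root_dvd[of r] pderiv_in_polys_over int_poly_in_polys_over is_subfield_Rats)
      (auto simp: croots_def)
  moreover have "pderiv (map_poly of_int f) \<noteq> (0 :: complex poly)"
    "degree (pderiv (map_poly of_int f) :: complex poly) < degree (map_poly of_int f :: complex poly)"
    unfolding map_f_eq by (auto simp: pderiv_eq_0_iff degree_pderiv)
  ultimately show False using dvd_imp_degree_le by fastforce
qed

lemma f_factor: "(map_poly of_int f :: complex poly) = (\<Prod>r\<in>R. [:- r, 1:])"
  using complex_poly_decompose_rsquarefree[OF rsquarefree_f]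
  unfolding croots_def by (simp add: quartic_def map_poly_pCons)

lemma finite_R: "finite R"
  by (rule finite_croots[OF f_nz])

lemma card_R: "card R = 4"
proof -
  have "degree (map_poly of_int f :: complex poly) = card R"
    unfolding f_factor by (subst degree_prod_eq_sum_degree) auto
  then show ?thesis by (simp add: map_f_eq)
qed

lemma vieta_roots:
  assumes "R = {r1, r2, r3, r4}" "distinct [r1, r2, r3, r4]"
  shows "vieta a b c d r1 r2 r3 r4"
proof -
  have "[:of_int d, of_int c, of_int b, of_int a, 1:] =
      [:- r1, 1:] * [:- r2, 1:] * [:- r3, 1:] * [:- r4, 1:]"
    using f_factor assms by (simp add: map_f_eq mult.assoc del: mult_pCons_left mult_pCons_right)
  then show ?thesis by (simp add: vieta_def algebra_simps)
qed

lemma R_subset_K: "R \<subseteq> K"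
  by (rule croots_subset_splitting_field)

lemma aut_hom: "\<sigma> \<in> G \<Longrightarrow> subfield_hom K \<sigma>"
  by unfold_locales (auto simp: field_auts_def hom_on_def is_subfield_splitting_field)

lemma aut_root: "\<sigma> \<in> G \<Longrightarrow> r \<in> R \<Longrightarrow> \<sigma> r \<in> R"
  using hom_croots[OF is_subfield_splitting_field subfield_hom.hom[OF aut_hom] R_subset_K f_nz] by blast

lemma aut_inj: "\<sigma> \<in> G \<Longrightarrow> inj_on \<sigma> K"
  by (auto simp: field_auts_def bij_betw_def)

lemma aut_closed: "\<sigma> \<in> G \<Longrightarrow> x \<in> K \<Longrightarrow> \<sigma> x \<in> K"
  by (auto simp: field_auts_def bij_betw_def)

text \<open>A rational polynomial vanishing at one root is divisible by \<open>f\<close> and so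
  vanishes at all roots; hence any two roots are conjugate.\<close>

lemma aut_transitive:
  assumes "r \<in> R" "r' \<in> R"
  obtains \<sigma> where "\<sigma> \<in> G" "\<sigma> r = r'"
proof (rule ex_field_aut[OF f_nz, of r "map_poly of_int f" r'])
  show "poly p r' = 0" if "p \<in> polys_over \<rat>" "poly p r = 0" for p
    using root_dvd[OF assms(1) that] assms(2) by (auto simp: croots_def)
qed (use assms R_subset_K f_nz int_poly_in_polys_over[OF is_subfield_Rats] of_int_poly_neq_0
      in \<open>auto simp: croots_def\<close>)

lemma one_in_G: "restrict id K \<in> G"
  using complex_subfield.closed[OF complex_subfield.intro[OF is_subfield_splitting_field[of f]]]
    complex_subfield.one_closed[OF complex_subfield.intro[OF is_subfield_splitting_field[of f]]]
  by (auto simp: field_auts_def bij_betw_def inj_on_def)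

lemma compose_in_G:
  assumes "\<sigma> \<in> G" "\<tau> \<in> G"
  shows "compose K \<sigma> \<tau> \<in> G"
proof -
  interpret \<sigma>: subfield_hom K \<sigma> by (rule aut_hom[OF assms(1)])
  interpret \<tau>: subfield_hom K \<tau> by (rule aut_hom[OF assms(2)])
  have "bij_betw (compose K \<sigma> \<tau>) K K"
    using assms by (intro bij_betw_compose) (auto simp: field_auts_def)
  then show ?thesis
    unfolding field_auts_def
    by (simp add: compose_eq \<sigma>.hom_add \<sigma>.hom_mult \<tau>.hom_add \<tau>.hom_mult \<sigma>.closed
        aut_closed[OF assms(2)])
qed

lemma root_orbit:
  assumes "r \<in> R"
  shows "R = (\<lambda>\<sigma>. \<sigma> r) ` G"
proof (intro equalityI subsetI)
  fix r' assume "r' \<in> R"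
  then show "r' \<in> (\<lambda>\<sigma>. \<sigma> r) ` G" using aut_transitive[OF assms] by blast
qed (use aut_root assms in auto)

text \<open>The orbit map at \<open>r\<close> sends \<open>G\<close> onto the four roots; with only
  four automorphisms it is injective.\<close>

lemma simply_transitive:
  assumes "card G = 4" "r \<in> R" "\<sigma> \<in> G" "\<tau> \<in> G" "\<sigma> r = \<tau> r"
  shows "\<sigma> = \<tau>"
proof -
  have "inj_on (\<lambda>\<sigma>. \<sigma> r) G"
    using assms(1) card_R root_orbit[OF assms(2)]
    by (intro eq_card_imp_inj_on) (auto intro: card_ge_0_finite)
  then show ?thesis using assms by (auto dest: inj_onD)
qed

text \<open>An element fixed by \<open>G\<close> is rational, and the monic integral
  \<open>p\<close> makes it an algebraic integer.\<close>

lemma fixed_int: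
  assumes x: "x \<in> K" and fixed: "\<And>\<sigma>. \<sigma> \<in> G \<Longrightarrow> \<sigma> x = x"
    and alg: "lead_coeff p = 1" "\<And>i. coeff p i \<in> \<int>" "poly p x = 0"
  shows "x \<in> \<int>"
proof -
  have "p \<in> polys_over \<rat>" "p \<noteq> 0"
    using alg Ints_subset_Rats by (auto simp: polys_over_def)
  then have "x \<in> \<rat>" using fixed_imp_Rats[OF f_nz x _ _ alg(3)] fixed by blast
  moreover have "algebraic_int x" using alg by (intro algebraic_int.intros[of p]) auto
  ultimately show ?thesis using rational_algebraic_int_is_int by blast
qed

lemma resolvent_int:
  assumes R: "R = {r1, r2, r3, r4}" "distinct [r1, r2, r3, r4]"
    and fixed: "\<And>\<sigma>. \<sigma> \<in> G \<Longrightarrow> \<sigma> (r1 * r2 + r3 * r4) = r1 * r2 + r3 * r4"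
  shows "r1 * r2 + r3 * r4 \<in> \<int>"
proof (rule fixed_int)
  interpret complex_subfield K using is_subfield_splitting_field by unfold_locales
  show "r1 * r2 + r3 * r4 \<in> K" using R R_subset_K by (intro closed) auto
  show "\<sigma> (r1 * r2 + r3 * r4) = r1 * r2 + r3 * r4" if "\<sigma> \<in> G" for \<sigma>
    by (rule fixed[OF that])
  show "poly [:- (of_int a ^ 2 * of_int d - 4 * of_int b * of_int d + of_int c ^ 2),
    of_int a * of_int c - 4 * of_int d, - of_int b, 1:] (r1 * r2 + r3 * r4) = 0"
    by (rule resolvent_root[OF vieta_roots[OF R]])
qed (auto simp: coeff_pCons split: nat.split)

text \<open>The automorphism carrying \<open>r1\<close> to \<open>r2\<close> is an involution
  without fixed roots, so it also exchanges \<open>r3\<close> and \<open>r4\<close>. Everything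
  commuting with it preserves the partition into these two pairs, whatever the numbering.\<close>

lemma V4_resolvent:
  assumes "card G = 4"
    and sq: "\<And>\<sigma> x. \<sigma> \<in> G \<Longrightarrow> x \<in> K \<Longrightarrow> \<sigma> (\<sigma> x) = x"
    and comm: "\<And>\<sigma> \<tau> x. \<sigma> \<in> G \<Longrightarrow> \<tau> \<in> G \<Longrightarrow> x \<in> K \<Longrightarrow> \<sigma> (\<tau> x) = \<tau> (\<sigma> x)"
    and R: "R = {r1, r2, r3, r4}" "distinct [r1, r2, r3, r4]"
  shows "r1 * r2 + r3 * r4 \<in> \<int>"
proof (rule resolvent_int[OF R])
  have RK: "r1 \<in> K" "r2 \<in> K" "r3 \<in> K" "r4 \<in> K" using R R_subset_K by auto
  obtain \<sigma> where \<sigma>: "\<sigma> \<in> G" "\<sigma> r1 = r2" using aut_transitive[of r1 r2] R by auto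
  have \<sigma>2: "\<sigma> r2 = r1" using sq[OF \<sigma>(1), of r1] \<sigma>(2) RK by simp
  have "\<sigma> r3 \<noteq> r3"
  proof
    assume "\<sigma> r3 = r3"
    then have "\<sigma> = restrict id K"
      using RK R by (intro simply_transitive[of r3] assms(1) \<sigma>(1) one_in_G) auto
    then show False using \<sigma>(2) RK R(2) by auto
  qed
  moreover have "\<sigma> r3 \<noteq> r1" "\<sigma> r3 \<noteq> r2"
    using sq[OF \<sigma>(1), of r3] \<sigma>(2) \<sigma>2 RK R(2) by auto
  ultimately have \<sigma>3: "\<sigma> r3 = r4" using aut_root[OF \<sigma>(1), of r3] R by auto
  then have \<sigma>4: "\<sigma> r4 = r3" using sq[OF \<sigma>(1), of r3] RK by simp
  fix \<tau> assume \<tau>: "\<tau> \<in> G"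
  interpret \<tau>: subfield_hom K \<tau> by (rule aut_hom[OF \<tau>])
  have 1: "\<tau> r2 = \<sigma> (\<tau> r1)" using comm[OF \<sigma>(1) \<tau>, of r1] \<sigma>(2) RK by simp
  have 2: "\<tau> r4 = \<sigma> (\<tau> r3)" using comm[OF \<sigma>(1) \<tau>, of r3] \<sigma>3 RK by simp
  have 3: "\<tau> r1 \<in> {r1, r2, r3, r4}" "\<tau> r3 \<in> {r1, r2, r3, r4}"
    using aut_root[OF \<tau>] R by auto
  have 4: "\<tau> r3 \<noteq> \<tau> r1" "\<tau> r3 \<noteq> \<tau> r2"
    using aut_inj[OF \<tau>] RK R(2) by (auto dest: inj_onD)
  have "\<tau> (r1 * r2 + r3 * r4) = \<tau> r1 * \<tau> r2 + \<tau> r3 * \<tau> r4"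
    using RK by (simp add: \<tau>.hom_add \<tau>.hom_mult \<tau>.closed)
  also have "\<dots> = r1 * r2 + r3 * r4"
    using 1 2 3 4 \<sigma>(2) \<sigma>2 \<sigma>3 \<sigma>4 by (elim insertE emptyE) (auto simp: ac_simps)
  finally show "\<tau> (r1 * r2 + r3 * r4) = r1 * r2 + r3 * r4" .
qed

text \<open>The two pairs are the orbits of the square of the generator, and the generator exchanges
  them. The second integer is what later yields the congruence modulo \<open>u\<close>.\<close>

lemma C4_resolvent:
  assumes \<sigma>: "\<sigma> \<in> G"
    and G: "card G = 4" "G \<subseteq> {restrict id K, \<sigma>, compose K \<sigma> \<sigma>, compose K \<sigma> (compose K \<sigma> \<sigma>)}"
    and id4: "\<And>x. x \<in> K \<Longrightarrow> \<sigma> (\<sigma> (\<sigma> (\<sigma> x))) = x"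
  obtains r1 r2 r3 r4 where "R = {r1, r2, r3, r4}" "distinct [r1, r2, r3, r4]"
    "r1 * r2 + r3 * r4 \<in> \<int>"
    "(r1 - r2) * (r3 - r4) * (r1 + r2 - r3 - r4) \<in> \<int>"
proof -
  obtain r where r: "r \<in> R" using card_R by fastforce
  \<comment> \<open>Along the 4-cycle of \<sigma> the roots are \<open>r1, r3, r2, r4\<close>, so
    opposite roots form a pair.\<close>
  define r1 r3 r2 r4 where "r1 = r" and "r3 = \<sigma> r" and "r2 = \<sigma> (\<sigma> r)" and "r4 = \<sigma> (\<sigma> (\<sigma> r))"
  have rR: "r1 \<in> R" "r2 \<in> R" "r3 \<in> R" "r4 \<in> R"
    by (simp_all add: r1_def r2_def r3_def r4_def aut_root[OF \<sigma>] r)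
  have rK: "r1 \<in> K" "r2 \<in> K" "r3 \<in> K" "r4 \<in> K" using rR R_subset_K by auto
  have cyc: "\<sigma> r1 = r3" "\<sigma> r3 = r2" "\<sigma> r2 = r4" "\<sigma> r4 = r1"
    using id4 rK by (auto simp: r1_def r2_def r3_def r4_def)
  have "R \<subseteq> (\<lambda>\<sigma>. \<sigma> r) ` {restrict id K, \<sigma>, compose K \<sigma> \<sigma>, compose K \<sigma> (compose K \<sigma> \<sigma>)}"
    using G(2) root_orbit[OF r] by blast
  then have "R \<subseteq> {r1, r2, r3, r4}"
    using rK by (auto simp: r1_def r2_def r3_def r4_def compose_def)
  then have R: "R = {r1, r2, r3, r4}" using rR by auto
  have dist: "distinct [r1, r2, r3, r4]"
    using card_R unfolding R by (intro card_distinct) simp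
  interpret \<sigma>: subfield_hom K \<sigma> by (rule aut_hom[OF \<sigma>])
  have fixed: "\<tau> x = x" if "\<tau> \<in> G" "x \<in> K" "\<sigma> x = x" for \<tau> x
  proof -
    have "\<tau> \<in> {restrict id K, \<sigma>, compose K \<sigma> \<sigma>, compose K \<sigma> (compose K \<sigma> \<sigma>)}"
      using G(2) that(1) by blast
    then show ?thesis by (elim insertE emptyE) (simp_all add: compose_eq that)
  qed
  have x: "r1 * r2 + r3 * r4 \<in> \<int>"
  proof (rule resolvent_int[OF R dist])
    fix \<tau> assume "\<tau> \<in> G"
    then show "\<tau> (r1 * r2 + r3 * r4) = r1 * r2 + r3 * r4"
    proof (rule fixed)
      show "r1 * r2 + r3 * r4 \<in> K" using rK by (intro \<sigma>.closed)
      show "\<sigma> (r1 * r2 + r3 * r4) = r1 * r2 + r3 * r4"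
        using rK cyc by (simp add: \<sigma>.hom_add \<sigma>.hom_mult \<sigma>.closed ac_simps)
    qed
  qed
  \<comment> \<open>\<sigma> sends \<open>r1 - r2\<close> to \<open>r3 - r4\<close>, sends
    \<open>r3 - r4\<close> to \<open>r2 - r1\<close>, and negates the last factor; the two signs
    cancel and \<open>y\<close> is fixed.\<close>
  define y where "y = (r1 - r2) * (r3 - r4) * (r1 + r2 - r3 - r4)"
  have "y ^ 2 \<in> \<int>"
  proof -
    have v: "of_int a = - (r1 + r2 + r3 + r4)"
      "of_int b = r1 * r2 + r1 * r3 + r1 * r4 + r2 * r3 + r2 * r4 + r3 * r4"
      "of_int c = - (r1 * r2 * r3 + r1 * r2 * r4 + r1 * r3 * r4 + r2 * r3 * r4)"
      "of_int d = r1 * r2 * r3 * r4"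
      using vieta_roots[OF R dist] by (auto simp: vieta_def)
    obtain X where X: "r1 * r2 + r3 * r4 = of_int X" using x by (auto elim: Ints_cases)
    \<comment> \<open>The first factor is the product of the discriminants of the quadratics with
      roots \<open>r1, r2\<close> and \<open>r3, r4\<close>; the second is the square of
      \<open>r1 + r2 - r3 - r4\<close>.\<close>
    have "y ^ 2 = of_int (((b - X) ^ 2 - 4 * (a * c - (b - X) * X) + 16 * d) * (a ^ 2 - 4 * b + 4 * X))"
      unfolding y_def by (simp add: v X[symmetric]) (simp add: algebra_simps power2_eq_square)
    then show ?thesis by simp
  qed
  then have y: "y \<in> \<int>"
  \<comment> \<open>\<open>y\<close> is a root of the monic quadratic with constant term
    \<open>- (y ^ 2)\<close>, which has just been shown to be an integer.\<close>
  proof (intro fixed_int[of y "[:- (y ^ 2), 0, 1:]"])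
    show yK: "y \<in> K" unfolding y_def using rK by (intro \<sigma>.closed)
    fix \<tau> assume "\<tau> \<in> G"
    then show "\<tau> y = y"
    proof (rule fixed[OF _ yK])
      show "\<sigma> y = y"
        unfolding y_def using rK cyc
        by (simp add: \<sigma>.hom_add \<sigma>.hom_diff \<sigma>.hom_mult \<sigma>.closed algebra_simps)
    qed
  qed (auto simp: coeff_pCons power2_eq_square split: nat.split)
  show ?thesis by (rule that[OF R dist x]) (use y in \<open>simp add: y_def\<close>)
qed

section \<open>From the isomorphism type to relations between automorphisms\<close>

lemma galois_group_sel:
  "carrier (galois_group f) = G"
  "x \<otimes>\<^bsub>galois_group f\<^esub> y = compose K x y"
  by (auto simp: galois_group_def)

lemma one_mult: "compose K (restrict id K) (restrict id K) = restrict id K"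
  by (auto simp: compose_def)

lemma V4_group:
  assumes "galois_group f \<cong> V4"
  shows "card G = 4"
    and "\<sigma> \<in> G \<Longrightarrow> x \<in> K \<Longrightarrow> \<sigma> (\<sigma> x) = x"
    and "\<sigma> \<in> G \<Longrightarrow> \<tau> \<in> G \<Longrightarrow> x \<in> K \<Longrightarrow> \<sigma> (\<tau> x) = \<tau> (\<sigma> x)"
proof -
  obtain h where h: "h \<in> hom (galois_group f) V4" "bij_betw h G (carrier V4)"
    using assms by (auto simp: is_iso_def iso_def galois_group_sel)
  have V4: "carrier V4 = {0..<2} \<times> {0..<2}"
    "p \<otimes>\<^bsub>V4\<^esub> q = ((fst p + fst q) mod 2, (snd p + snd q) mod 2)" for p q
    by (cases p; cases q; auto simp: V4_def carrier_integer_mod_group DirProd_def integer_mod_group_def)+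
  show "card G = 4" using bij_betw_same_card[OF h(2)] by (simp add: V4)
  have hc: "h \<sigma> \<in> {0..<2} \<times> {0..<2}" if "\<sigma> \<in> G" for \<sigma>
    using h(2) that V4(1) by (auto simp: bij_betw_def)
  have hm: "h (compose K \<sigma> \<tau>) = ((fst (h \<sigma>) + fst (h \<tau>)) mod 2, (snd (h \<sigma>) + snd (h \<tau>)) mod 2)"
    if "\<sigma> \<in> G" "\<tau> \<in> G" for \<sigma> \<tau>
    using h(1) that by (simp add: hom_def galois_group_sel V4)
  have inj: "\<sigma> = \<tau>" if "h \<sigma> = h \<tau>" "\<sigma> \<in> G" "\<tau> \<in> G" for \<sigma> \<tau>
    using h(2) that by (auto simp: bij_betw_def dest: inj_onD)
  \<comment> \<open>The image of the identity equals its own double, which leaves only 0.\<close>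
  have one: "h (restrict id K) = (0, 0)"
    using hm[OF one_in_G one_in_G] hc[OF one_in_G] unfolding one_mult by (cases "h (restrict id K)") auto
  show "\<sigma> (\<sigma> x) = x" if "\<sigma> \<in> G" "x \<in> K"
  proof -
    have "compose K \<sigma> \<sigma> = restrict id K"
      using that by (intro inj compose_in_G one_in_G) (auto simp: hm one)
    from fun_cong[OF this, of x] show ?thesis using that by (simp add: compose_def)
  qed
  show "\<sigma> (\<tau> x) = \<tau> (\<sigma> x)" if "\<sigma> \<in> G" "\<tau> \<in> G" "x \<in> K"
  proof -
    have "compose K \<sigma> \<tau> = compose K \<tau> \<sigma>"
      using that by (intro inj compose_in_G) (auto simp: hm add.commute)
    from fun_cong[OF this, of x] show ?thesis using that by (simp add: compose_def)
  qed
qed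

lemma C4_group:
  assumes "galois_group f \<cong> C4"
  obtains \<sigma> where "\<sigma> \<in> G" "card G = 4"
    "G \<subseteq> {restrict id K, \<sigma>, compose K \<sigma> \<sigma>, compose K \<sigma> (compose K \<sigma> \<sigma>)}"
    "\<And>x. x \<in> K \<Longrightarrow> \<sigma> (\<sigma> (\<sigma> (\<sigma> x))) = x"
proof -
  obtain h where h: "h \<in> hom (galois_group f) C4" "bij_betw h G (carrier C4)"
    using assms by (auto simp: is_iso_def iso_def galois_group_sel)
  have C4: "carrier C4 = {0..<4}" "p \<otimes>\<^bsub>C4\<^esub> q = (p + q) mod 4" for p q
    by (auto simp: C4_def carrier_integer_mod_group integer_mod_group_def)
  have card: "card G = 4" using bij_betw_same_card[OF h(2)] by (simp add: C4)
  have hc: "h \<sigma> \<in> {0..<4}" if "\<sigma> \<in> G" for \<sigma>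
    using h(2) that C4(1) by (auto simp: bij_betw_def)
  have hm: "h (compose K \<sigma> \<tau>) = (h \<sigma> + h \<tau>) mod 4" if "\<sigma> \<in> G" "\<tau> \<in> G" for \<sigma> \<tau>
    using h(1) that by (simp add: hom_def galois_group_sel C4)
  have inj: "\<sigma> = \<tau>" if "h \<sigma> = h \<tau>" "\<sigma> \<in> G" "\<tau> \<in> G" for \<sigma> \<tau>
    using h(2) that by (auto simp: bij_betw_def dest: inj_onD)
  have one: "h (restrict id K) = 0"
    using hm[OF one_in_G one_in_G] hc[OF one_in_G] unfolding one_mult by auto presburger
  \<comment> \<open>A preimage \<sigma> of 1 generates \<open>G\<close>: its square and cube have
    images 2 and 3, and \<open>h\<close> is injective.\<close>
  have "1 \<in> h ` G" using h(2) C4(1) by (auto simp: bij_betw_def)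
  then obtain \<sigma> where \<sigma>: "\<sigma> \<in> G" "h \<sigma> = 1" by auto
  have \<sigma>2: "compose K \<sigma> \<sigma> \<in> G" "h (compose K \<sigma> \<sigma>) = 2"
    using \<sigma> by (auto simp: hm intro: compose_in_G)
  have \<sigma>3: "compose K \<sigma> (compose K \<sigma> \<sigma>) \<in> G" "h (compose K \<sigma> (compose K \<sigma> \<sigma>)) = 3"
    using \<sigma> \<sigma>2 by (auto simp: hm intro: compose_in_G)
  show ?thesis
  proof (rule that[OF \<sigma>(1) card])
    show "G \<subseteq> {restrict id K, \<sigma>, compose K \<sigma> \<sigma>, compose K \<sigma> (compose K \<sigma> \<sigma>)}"
    proof
      fix \<tau> assume \<tau>: "\<tau> \<in> G"
      then have "h \<tau> = 0 \<or> h \<tau> = 1 \<or> h \<tau> = 2 \<or> h \<tau> = 3" using hc[of \<tau>] by auto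
      then show "\<tau> \<in> {restrict id K, \<sigma>, compose K \<sigma> \<sigma>, compose K \<sigma> (compose K \<sigma> \<sigma>)}"
        using inj[OF _ \<tau> one_in_G] inj[OF _ \<tau> \<sigma>(1)] inj[OF _ \<tau> \<sigma>2(1)] inj[OF _ \<tau> \<sigma>3(1)]
          one \<sigma>(2) \<sigma>2(2) \<sigma>3(2) by auto
    qed
    have 4: "compose K \<sigma> (compose K \<sigma> (compose K \<sigma> \<sigma>)) = restrict id K"
      using \<sigma> \<sigma>3 by (intro inj compose_in_G one_in_G) (auto simp: hm one)
    show "\<sigma> (\<sigma> (\<sigma> (\<sigma> x))) = x" if "x \<in> K" for x
      using fun_cong[OF 4, of x] that by (simp add: compose_def)
  qed
qed

end

section \<open>Parametrization by the resolvent root\<close>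

lemma squarefree_dvd_square:
  fixes u L :: int
  assumes u: "squarefree u" and dvd: "u dvd L\<^sup>2"
  shows "u dvd L"
proof -
  \<comment> \<open>The cofactor \<open>n\<close> of \<open>g\<close> in \<open>u\<close> is coprime
    to that of \<open>L\<close>, hence divides \<open>g\<close>; then its square divides the
    squarefree \<open>u\<close>.\<close>
  define g where "g = gcd u L"
  have g0: "g \<noteq> 0" using u by (auto simp: g_def)
  obtain n m where nm: "u = n * g" "L = m * g" "coprime n m"
    using gcd_coprime_exists[of u L] g0 unfolding g_def by auto
  have "n dvd g * m\<^sup>2" using dvd g0 unfolding nm by (simp add: power2_eq_square ac_simps)
  then have "n dvd g" using nm(3) by (simp add: coprime_dvd_mult_left_iff)
  then have "n\<^sup>2 dvd u" unfolding nm power2_eq_square by (rule mult_dvd_mono[OF dvd_refl])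
  then have "n dvd 1" using u by (auto simp: squarefree_def)
  then show ?thesis unfolding nm by (simp add: unit_imp_dvd)
qed

text \<open>Squarefreeness first gives \<open>u dvd L\<close>. Dividing out leaves
  \<open>w^2 * M = u * k^2\<close>; the cofactor of \<open>gcd w k\<close> in \<open>w\<close> then
  has a square dividing \<open>u\<close>, so it is a unit and \<open>w\<close> divides
  \<open>k\<close>.\<close>

lemma squarefree_square_quotient:
  fixes u w M L :: int
  assumes u: "squarefree u" and w: "w \<noteq> 0" and eq: "u * w\<^sup>2 * M = L\<^sup>2"
  obtains v where "L = u * w * v" "M = u * v\<^sup>2"
proof -
  have u0: "u \<noteq> 0" using u by (metis not_squarefree_0)
  have uL: "u dvd L" by (rule squarefree_dvd_square[OF u]) (simp flip: eq add: mult.assoc)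
  then obtain k where k: "L = u * k" by auto
  have "u * (w\<^sup>2 * M) = u * (u * k\<^sup>2)" using eq unfolding k by (simp add: power2_eq_square mult.assoc mult.left_commute)
  then have eq2: "w\<^sup>2 * M = u * k\<^sup>2" using u0 by (simp only: mult_cancel_left) simp
  define g where "g = gcd w k"
  have g0: "g \<noteq> 0" using w by (simp add: g_def)
  obtain n m where nm: "w = n * g" "k = m * g" "coprime n m"
    using gcd_coprime_exists[of w k] g0 unfolding g_def by auto
  have eq3: "n\<^sup>2 * M = u * m\<^sup>2" using eq2 g0 unfolding nm by (simp add: power2_eq_square)
  have "n\<^sup>2 dvd u * m\<^sup>2" using eq3 by (metis dvd_triv_left)
  then have "n\<^sup>2 dvd u" using nm(3) by (simp add: coprime_dvd_mult_left_iff)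
  then have "n dvd 1" using u by (auto simp: squarefree_def)
  then have "w dvd k" unfolding nm by (simp add: unit_imp_dvd)
  then obtain v where v: "k = w * v" by auto
  show ?thesis
  proof (rule that[of v])
    show "L = u * w * v" by (simp add: k v)
    show "M = u * v\<^sup>2" using eq2 w unfolding v by (simp add: power2_eq_square)
  qed
qed

text \<open>With \<open>p = (r1 - r2)^2\<close> and \<open>q = (r3 - r4)^2\<close>, the fourth
  identity is four times \<open>(p + q)^2 = (p - q)^2 + 4 * p * q\<close>, where
  \<open>p - q = - (a * \<theta> + 4 * \<phi>)\<close>. The fifth is the product of the
  discriminants of the two quadratic factors.\<close>

lemma vieta_resolvent_identities:
  assumes "vieta a b c d r1 r2 r3 r4" and x: "r1 * r2 + r3 * r4 = of_int x"
  defines "\<theta> \<equiv> r1 + r2 - r3 - r4" and "\<phi> \<equiv> r1 * r2 - r3 * r4"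
  shows "\<theta>\<^sup>2 = of_int (a\<^sup>2 - 4 * b + 4 * x)" "\<phi>\<^sup>2 = of_int (x\<^sup>2 - 4 * d)"
    "\<theta> * \<phi> = of_int (2 * c - a * x)"
    "(of_int (2 * a\<^sup>2 - 4 * b - 4 * x))\<^sup>2 =
       4 * (of_int a * \<theta> + 4 * \<phi>)\<^sup>2 + 16 * ((r1 - r2) * (r3 - r4))\<^sup>2"
    "((r1 - r2) * (r3 - r4))\<^sup>2 = of_int ((b - x)\<^sup>2 - 4 * (a * c - (b - x) * x) + 16 * d)"
proof -
  have v: "of_int a = - (r1 + r2 + r3 + r4)"
      "of_int b = r1 * r2 + r1 * r3 + r1 * r4 + r2 * r3 + r2 * r4 + r3 * r4"
      "of_int c = - (r1 * r2 * r3 + r1 * r2 * r4 + r1 * r3 * r4 + r2 * r3 * r4)"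
      "of_int d = r1 * r2 * r3 * r4"
    using assms(1) by (auto simp: vieta_def)
  show "\<theta>\<^sup>2 = of_int (a\<^sup>2 - 4 * b + 4 * x)"
    unfolding \<theta>_def by (simp add: v x[symmetric]) (simp add: algebra_simps power2_eq_square)
  show "\<phi>\<^sup>2 = of_int (x\<^sup>2 - 4 * d)"
    unfolding \<phi>_def by (simp add: v x[symmetric]) (simp add: algebra_simps power2_eq_square)
  show "\<theta> * \<phi> = of_int (2 * c - a * x)"
    unfolding \<theta>_def \<phi>_def by (simp add: v x[symmetric]) (simp add: algebra_simps power2_eq_square)
  show "(of_int (2 * a\<^sup>2 - 4 * b - 4 * x))\<^sup>2 =
       4 * (of_int a * \<theta> + 4 * \<phi>)\<^sup>2 + 16 * ((r1 - r2) * (r3 - r4))\<^sup>2"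
    unfolding \<theta>_def \<phi>_def by (simp add: v x[symmetric]) (simp add: algebra_simps power2_eq_square)
  show "((r1 - r2) * (r3 - r4))\<^sup>2 = of_int ((b - x)\<^sup>2 - 4 * (a * c - (b - x) * x) + 16 * d)"
    by (simp add: v x[symmetric]) (simp add: algebra_simps power2_eq_square)
qed

text \<open>\<theta>^2 is a nonzero integer with squarefree part \<open>u\<close>. Its product with
  the integer \<phi>^2 is the square of an integer, so \<phi>^2 is \<open>u\<close> times a square
  as well.\<close>

lemma resolvent_parametrization:
  assumes V: "vieta a b c d r1 r2 r3 r4" and x: "r1 * r2 + r3 * r4 = of_int x"
    and nz: "r1 + r2 - r3 - r4 \<noteq> 0"
  obtains u w v :: int where "squarefree u" "w \<noteq> 0"
    "4 * b = a\<^sup>2 + 4 * x - u * w\<^sup>2" "4 * d = x\<^sup>2 - u * v\<^sup>2" "2 * c = a * x + u * v * w"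
    "r1 + r2 - r3 - r4 = of_int w * csqrt (of_int u)"
    "r1 * r2 - r3 * r4 = of_int v * csqrt (of_int u)"
proof -
  define \<theta> \<phi> where "\<theta> = r1 + r2 - r3 - r4" and "\<phi> = r1 * r2 - r3 * r4"
  define N where "N = a\<^sup>2 - 4 * b + 4 * x"
  note ids = vieta_resolvent_identities[OF V x, folded \<theta>_def \<phi>_def]
  have \<theta>0: "\<theta> \<noteq> 0" using nz by (simp add: \<theta>_def)
  have "N \<noteq> 0" using ids(1) \<theta>0 unfolding N_def by (metis of_int_0 power2_eq_square mult_eq_0_iff)
  define u :: int where "u = squarefree_part N"
  define w0 :: int where "w0 = square_part N"
  have Nu: "N = u * w0\<^sup>2" unfolding u_def w0_def by (rule squarefree_decompose)
  have u: "squarefree u" unfolding u_def by simp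
  have w0: "w0 \<noteq> 0" using \<open>N \<noteq> 0\<close> Nu by auto
  have u0: "u \<noteq> 0" using u by (metis not_squarefree_0)
  have "of_int (N * (x\<^sup>2 - 4 * d)) = (of_int ((2 * c - a * x)\<^sup>2) :: complex)"
    using ids(1-3) unfolding N_def of_int_mult of_int_power by (metis power_mult_distrib)
  then have "u * w0\<^sup>2 * (x\<^sup>2 - 4 * d) = (2 * c - a * x)\<^sup>2"
    unfolding Nu[symmetric] by (simp only: of_int_eq_iff)
  then obtain v0 where v0: "2 * c - a * x = u * w0 * v0" "x\<^sup>2 - 4 * d = u * v0\<^sup>2"
    using squarefree_square_quotient[OF u w0] by metis
  let ?s = "csqrt (of_int u)"
  have s2: "?s\<^sup>2 = of_int u" by simp
  have s0: "?s \<noteq> 0" using u0 by simp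
  have "\<theta>\<^sup>2 = (of_int w0 * ?s)\<^sup>2"
    using ids(1) Nu unfolding N_def[symmetric] by (simp add: power_mult_distrib)
  then have "\<theta> = of_int w0 * ?s \<or> \<theta> = - (of_int w0 * ?s)" by (simp add: power2_eq_iff)
  \<comment> \<open>\<open>csqrt\<close> selects one of the two square roots of \<open>u\<close>.
    The sign needed for \<theta> is put into both \<open>w\<close> and \<open>v\<close>, which
    leaves \<open>w^2\<close>, \<open>v^2\<close> and \<open>v * w\<close> unchanged.\<close>
  then obtain \<epsilon> :: int where \<epsilon>: "\<epsilon> = 1 \<or> \<epsilon> = - 1" "\<theta> = of_int (\<epsilon> * w0) * ?s"
    by (metis mult_1 mult_minus1 of_int_minus mult_minus_left)
  have e2: "\<epsilon> * \<epsilon> = 1" using \<epsilon>(1) by auto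
  show ?thesis
  proof (rule that[of u "\<epsilon> * w0" "\<epsilon> * v0"])
    \<comment> \<open>The value of \<phi>, including its sign, is recovered by cancelling the
      nonzero \<theta> from the known product.\<close>
    have "\<theta> * \<phi> = \<theta> * (of_int (\<epsilon> * v0) * ?s)"
    proof -
      have "\<theta> * (of_int (\<epsilon> * v0) * ?s) = of_int (\<epsilon> * \<epsilon>) * of_int w0 * of_int v0 * ?s\<^sup>2"
        unfolding \<epsilon>(2) by (simp add: power2_eq_square)
      also have "\<dots> = of_int (2 * c - a * x)" unfolding e2 s2 v0 by simp
      finally show ?thesis using ids(3) by simp
    qed
    then have "\<phi> = of_int (\<epsilon> * v0) * ?s" using \<theta>0 by simp
    then show "r1 * r2 - r3 * r4 = of_int (\<epsilon> * v0) * ?s" by (simp add: \<phi>_def)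
    show "r1 + r2 - r3 - r4 = of_int (\<epsilon> * w0) * ?s" using \<epsilon>(2) by (simp add: \<theta>_def)
    have sq: "(\<epsilon> * t)\<^sup>2 = t\<^sup>2" for t using e2 by (simp add: power_mult_distrib power2_eq_square)
    show "4 * b = a\<^sup>2 + 4 * x - u * (\<epsilon> * w0)\<^sup>2" using Nu unfolding sq N_def by simp
    show "4 * d = x\<^sup>2 - u * (\<epsilon> * v0)\<^sup>2" using v0(2) unfolding sq by simp
    have "u * (\<epsilon> * v0) * (\<epsilon> * w0) = (\<epsilon> * \<epsilon>) * (u * w0 * v0)" by (simp add: algebra_simps)
    then show "2 * c = a * x + u * (\<epsilon> * v0) * (\<epsilon> * w0)" using v0(1) unfolding e2 by linarith
    show "\<epsilon> * w0 \<noteq> 0" using w0 \<epsilon>(1) by auto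
  qed (rule u)
qed

text \<open>Twice the trace of \<open>(r\<^sub>1 - r\<^sub>2)\<^sup>2\<close> over the rationals is \<open>2 a\<^sup>2 - 4 b - 4 x\<close>; its square is divisible
  by \<open>u\<close> because \<open>((r\<^sub>1 - r\<^sub>2) (r\<^sub>3 - r\<^sub>4))\<^sup>2\<close> is \<open>u\<close> times a square.\<close>
lemma resolvent_dvd:
  assumes V: "vieta a b c d r1 r2 r3 r4" and x: "r1 * r2 + r3 * r4 = of_int x"
    and y: "(r1 - r2) * (r3 - r4) * (r1 + r2 - r3 - r4) \<in> \<int>"
    and u: "squarefree u" "w \<noteq> 0"
    and \<theta>: "r1 + r2 - r3 - r4 = of_int w * csqrt (of_int u)"
    and \<phi>: "r1 * r2 - r3 * r4 = of_int v * csqrt (of_int u)"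
    and b: "4 * b = a\<^sup>2 + 4 * x - u * w\<^sup>2"
  shows "u dvd a\<^sup>2 - 8 * x"
proof -
  note ids = vieta_resolvent_identities[OF V x]
  let ?s = "csqrt (of_int u)"
  have s2: "?s\<^sup>2 = of_int u" by simp
  obtain Z where Z: "(r1 - r2) * (r3 - r4) * (of_int w * ?s) = of_int Z"
    using y unfolding \<theta> by (auto elim: Ints_cases)
  \<comment> \<open>\<open>Y\<close> is the product of the two discriminants; the integrality of
    \<open>Z\<close> makes \<open>u * w^2 * Y\<close> a square.\<close>
  define Y where "Y = (b - x)\<^sup>2 - 4 * (a * c - (b - x) * x) + 16 * d"
  have "of_int (Z\<^sup>2) = ((r1 - r2) * (r3 - r4))\<^sup>2 * (of_int w)\<^sup>2 * ?s\<^sup>2"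
    unfolding of_int_power Z[symmetric] by (simp only: power_mult_distrib mult.assoc)
  then have "of_int (u * w\<^sup>2 * Y) = (of_int (Z\<^sup>2) :: complex)"
    unfolding ids(5) Y_def[symmetric] s2 by simp
  then have "u * w\<^sup>2 * Y = Z\<^sup>2" by (simp only: of_int_eq_iff)
  then obtain z where z: "Y = u * z\<^sup>2" using squarefree_square_quotient[OF u] by metis
  have "of_int a * (of_int w * ?s) + 4 * (of_int v * ?s) = of_int (a * w + 4 * v) * ?s"
    by (simp add: algebra_simps)
  then have "of_int ((2 * a\<^sup>2 - 4 * b - 4 * x)\<^sup>2) =
      (of_int (4 * (u * (a * w + 4 * v)\<^sup>2) + 16 * (u * z\<^sup>2)) :: complex)"
    using ids(4) unfolding ids(5) Y_def[symmetric] z \<theta> \<phi> by (simp add: power_mult_distrib)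
  then have "(2 * a\<^sup>2 - 4 * b - 4 * x)\<^sup>2 = 4 * (u * (a * w + 4 * v)\<^sup>2) + 16 * (u * z\<^sup>2)"
    by (simp only: of_int_eq_iff)
  then have "(2 * a\<^sup>2 - 4 * b - 4 * x)\<^sup>2 = u * (4 * (a * w + 4 * v)\<^sup>2 + 16 * z\<^sup>2)"
    by (simp add: algebra_simps)
  then have "u dvd (2 * a\<^sup>2 - 4 * b - 4 * x)\<^sup>2" by (rule dvdI)
  then have "u dvd 2 * a\<^sup>2 - 4 * b - 4 * x" by (rule squarefree_dvd_square[OF u(1)])
  moreover have "2 * a\<^sup>2 - 4 * b - 4 * x = a\<^sup>2 - 8 * x + u * w\<^sup>2" using b by linarith
  ultimately have "u dvd a\<^sup>2 - 8 * x + u * w\<^sup>2" by simp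
  then show ?thesis by (simp add: dvd_add_left_iff)
qed

text \<open>The product is the Mahler measure of the monic \<open>f\<close>. Landau's inequality
  bounds it by the Euclidean norm of the coefficients, at most the square root of
  \<open>1 + 4 * H^2\<close>, hence at most \<open>3 * H\<close>.\<close>

lemma (in galois_quartic) mahler_bound:
  assumes R: "R = {r1, r2, r3, r4}" "distinct [r1, r2, r3, r4]"
    and H: "\<bar>a\<bar> \<le> int H" "\<bar>b\<bar> \<le> int H" "\<bar>c\<bar> \<le> int H" "\<bar>d\<bar> \<le> int H" "1 \<le> H"
  shows "max 1 (cmod r1) * max 1 (cmod r2) * max 1 (cmod r3) * max 1 (cmod r4) \<le> 3 * real H"
proof -
  have "map_poly of_int f = smult 1 (\<Prod>r\<leftarrow>[r1, r2, r3, r4]. [:- r, 1:])"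
    unfolding f_factor using R by (simp del: mult_pCons_left mult_pCons_right)
  then have "mahler_measure f = max 1 (cmod r1) * max 1 (cmod r2) * max 1 (cmod r3) * max 1 (cmod r4)"
    unfolding mahler_measure_def by (simp only: mahler_measure_poly_explicit) simp
  moreover have "mahler_measure f \<le> sqrt (real_of_int (\<Sum>a\<leftarrow>coeffs f. a * a))"
    by (rule Landau_inequality_mahler_measure)
  moreover have "(\<Sum>a\<leftarrow>coeffs f. a * a) = 1 + a\<^sup>2 + b\<^sup>2 + c\<^sup>2 + d\<^sup>2"
    by (simp add: quartic_def cCons_def power2_eq_square)
  moreover have "\<dots> \<le> (3 * int H)\<^sup>2"
  proof -
    have t: "t\<^sup>2 \<le> (int H)\<^sup>2" if "\<bar>t\<bar> \<le> int H" for t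
      using that by (metis abs_le_square_iff abs_of_nat)
    have "1 \<le> (int H)\<^sup>2" using H(5) by simp
    moreover have "(3 * int H)\<^sup>2 = 9 * (int H)\<^sup>2" by (simp add: power_mult_distrib)
    ultimately show ?thesis using t[OF H(1)] t[OF H(2)] t[OF H(3)] t[OF H(4)] by linarith
  qed
  then have "sqrt (real_of_int (1 + a\<^sup>2 + b\<^sup>2 + c\<^sup>2 + d\<^sup>2)) \<le> 3 * real H"
    by (intro real_le_lsqrt) (auto simp flip: of_int_le_iff[where 'a=real])
  ultimately show ?thesis by simp
qed

section \<open>Lattice points\<close>

text \<open>The half-open cells of length \<mu> starting at \<open>t - X\<close> contain at most one
  element of \<open>S\<close> each; \<open>h\<close> gives the number of the cell.\<close>

lemma card_spaced_le:
  fixes S :: "int set" and t X \<mu> :: real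
  assumes \<mu>: "\<mu> > 0" and X: "X \<ge> 0"
    and near: "\<And>n. n \<in> S \<Longrightarrow> \<bar>of_int n - t\<bar> \<le> X"
    and sep: "\<And>m n. m \<in> S \<Longrightarrow> n \<in> S \<Longrightarrow> m \<noteq> n \<Longrightarrow> \<mu> \<le> \<bar>of_int (m - n)\<bar>"
  shows "finite S \<and> real (card S) \<le> 2 * X / \<mu> + 1"
proof -
  define h where "h = (\<lambda>n::int. \<lfloor>(of_int n - (t - X)) / \<mu>\<rfloor>)"
  define M where "M = \<lfloor>2 * X / \<mu>\<rfloor>"
  have inj: "inj_on h S"
  proof (rule inj_onI, rule ccontr)
    fix m n assume mn: "m \<in> S" "n \<in> S" "h m = h n" "m \<noteq> n"
    have "\<bar>(of_int m - (t - X)) / \<mu> - (of_int n - (t - X)) / \<mu>\<bar> < 1"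
      using mn(3) unfolding h_def by linarith
    then have "\<bar>of_int (m - n) / \<mu>\<bar> < 1" by (simp add: diff_divide_distrib)
    then have "\<bar>of_int (m - n)\<bar> < \<mu>" using \<mu> by (simp add: abs_divide)
    then show False using sep[OF mn(1,2,4)] by simp
  qed
  have sub: "h ` S \<subseteq> {0..M}"
  proof (rule image_subsetI)
    fix n assume "n \<in> S"
    then have "0 \<le> of_int n - (t - X)" "of_int n - (t - X) \<le> 2 * X" using near[of n] by linarith+
    then have "0 \<le> (of_int n - (t - X)) / \<mu>" "(of_int n - (t - X)) / \<mu> \<le> 2 * X / \<mu>"
      using \<mu> by (auto intro: divide_right_mono)
    then show "h n \<in> {0..M}" unfolding h_def M_def by (auto intro: floor_mono)
  qed
  have "0 \<le> M" using \<mu> X by (simp add: M_def)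
  have "card S \<le> card {0..M}" using card_inj_on_le[OF inj sub] by simp
  also have "real \<dots> = of_int M + 1" using \<open>0 \<le> M\<close> by simp
  also have "\<dots> \<le> 2 * X / \<mu> + 1" unfolding M_def by simp
  finally show ?thesis using inj_on_finite[OF inj sub] by simp
qed

lemma card_near_le:
  fixes S :: "int set" and z :: complex
  assumes "X \<ge> 0" "\<And>n. n \<in> S \<Longrightarrow> cmod (of_int n - z) \<le> X"
  shows "finite S \<and> real (card S) \<le> 2 * X + 1"
proof -
  have "\<bar>of_int n - Re z\<bar> \<le> X" if "n \<in> S" for n
    using assms(2)[OF that] abs_Re_le_cmod[of "of_int n - z"] by simp
  then show ?thesis using card_spaced_le[of 1 X S "Re z"] assms(1) by force
qed

lemma card_Sigma_le:
  assumes "finite I" "\<And>i. i \<in> I \<Longrightarrow> finite (B i) \<and> real (card (B i)) \<le> k"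
  shows "finite (Sigma I B) \<and> real (card (Sigma I B)) \<le> real (card I) * k"
proof -
  have "real (card (Sigma I B)) = (\<Sum>i\<in>I. real (card (B i)))"
    using assms by (simp add: card_SigmaI)
  also have "\<dots> \<le> (\<Sum>i\<in>I. k)" using assms by (intro sum_mono) auto
  finally show ?thesis using assms by auto
qed

text \<open>The bounds limit in order the absolute values of \<theta>, \<phi>,
  \<open>2 * (r3 + r4)\<close> and \<open>2 * r3 * r4\<close>; \<open>C\<close> carries the
  congruence of the cyclic case.\<close>

definition param_box :: "int \<Rightarrow> real \<Rightarrow> real \<Rightarrow> real \<Rightarrow> real \<Rightarrow> (int \<Rightarrow> int \<Rightarrow> bool) \<Rightarrow> ((int \<times> int) \<times> int \<times> int) set" where
  "param_box u P Q A X C = {((w, v), a, x). w \<noteq> 0 \<and>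
     cmod (of_int w * csqrt (of_int u)) \<le> P \<and> cmod (of_int v * csqrt (of_int u)) \<le> Q \<and>
     cmod (of_int a + of_int w * csqrt (of_int u)) \<le> A \<and>
     cmod (of_int x - of_int v * csqrt (of_int u)) \<le> X \<and> C a x}"

lemma norm_csqrt_of_int: "cmod (csqrt (of_int u)) = sqrt \<bar>of_int u\<bar>"
proof -
  have "cmod (csqrt (of_int u)) ^ 2 = \<bar>of_int u\<bar>"
    by (metis norm_power power2_csqrt norm_of_int)
  then show ?thesis by (metis abs_norm_cancel real_sqrt_abs)
qed

text \<open>The condition \<open>w \<noteq> 0\<close> forces \<open>\<surd>\<bar>u\<bar> \<le> P \<le> Q\<close>, so the \<open>+ 1\<close> in the numbers of \<open>w\<close> and \<open>v\<close> is absorbed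
  into their main terms.\<close>
lemma card_box_le:
  assumes u: "u \<noteq> 0" and PQ: "0 \<le> P" "P \<le> Q" and A: "A \<ge> 0" and X: "X \<ge> 0" and \<mu>: "\<mu> > 0"
    and sep: "\<And>a x x'. C a x \<Longrightarrow> C a x' \<Longrightarrow> x \<noteq> x' \<Longrightarrow> \<mu> \<le> \<bar>of_int (x - x')\<bar>"
  shows "finite (param_box u P Q A X C) \<and>
    real (card (param_box u P Q A X C)) \<le> 9 * P * Q / \<bar>of_int u\<bar> * ((2 * A + 1) * (2 * X / \<mu> + 1))"
proof (cases "sqrt \<bar>of_int u\<bar> \<le> P")
  case False
  have False if "w \<noteq> 0" "cmod (of_int w * csqrt (of_int u)) \<le> P" for w :: int
  proof -
    have "1 \<le> \<bar>real_of_int w\<bar>" using that(1) by linarith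
    then have "1 * sqrt \<bar>real_of_int u\<bar> \<le> \<bar>of_int w\<bar> * sqrt \<bar>of_int u\<bar>"
      by (intro mult_right_mono) auto
    then show False using that(2) False by (simp add: norm_mult norm_csqrt_of_int)
  qed
  then have "param_box u P Q A X C = {}" by (auto simp: param_box_def)
  then show ?thesis using PQ A X \<mu> by simp
next
  case True
  define s where "s = sqrt \<bar>real_of_int u\<bar>"
  have s0: "s > 0" using u by (simp add: s_def)
  have ss: "s * s = \<bar>real_of_int u\<bar>" by (simp add: s_def)
  have sP: "1 \<le> P / s" using True s0 by (simp add: s_def)
  have sQ: "1 \<le> Q / s" using sP PQ(2) s0 by (simp add: field_simps)
  define W where "W = (\<lambda>P. {w::int. cmod (of_int w * csqrt (of_int u)) \<le> P})"
  have W: "finite (W P) \<and> real (card (W P)) \<le> 3 * (P / s)" if "1 \<le> P / s" for P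
  proof -
    have "finite (W P) \<and> real (card (W P)) \<le> 2 * (P / s) + 1"
    proof (rule card_near_le[of _ _ 0])
      show "cmod (of_int n - 0) \<le> P / s" if "n \<in> W P" for n
        using that s0 by (simp add: W_def norm_mult norm_csqrt_of_int s_def[symmetric] field_simps)
    qed (use that in auto)
    then show ?thesis using that by auto
  qed
  \<comment> \<open>For given \<open>w\<close> and \<open>v\<close>, the integers \<open>a\<close>
    lie in a disc, which leaves at most \<open>2 * A + 1\<close> of them, and for each
    \<open>a\<close> the values of \<open>x\<close> are \<mu>-separated.\<close>
  define B where "B = (\<lambda>(w::int, v). SIGMA a:{a. cmod (of_int a - (- (of_int w * csqrt (of_int u)))) \<le> A}.
    {x. C a x \<and> cmod (of_int x - of_int v * csqrt (of_int u)) \<le> X})"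
  have B: "finite (B p) \<and> real (card (B p)) \<le> (2 * A + 1) * (2 * X / \<mu> + 1)" for p
  proof -
    obtain w v where p: "p = (w, v)" by (cases p)
    define Ia where "Ia = {a. cmod (of_int a - (- (of_int w * csqrt (of_int u)))) \<le> A}"
    have Ia: "finite Ia \<and> real (card Ia) \<le> 2 * A + 1"
      by (rule card_near_le[OF A, of _ "- (of_int w * csqrt (of_int u))"]) (simp add: Ia_def)
    have "finite {x. C a x \<and> cmod (of_int x - of_int v * csqrt (of_int u)) \<le> X} \<and>
      real (card {x. C a x \<and> cmod (of_int x - of_int v * csqrt (of_int u)) \<le> X}) \<le> 2 * X / \<mu> + 1" for a
    proof (rule card_spaced_le[OF \<mu> X])
      fix n assume "n \<in> {x. C a x \<and> cmod (of_int x - of_int v * csqrt (of_int u)) \<le> X}"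
      then show "\<bar>of_int n - Re (of_int v * csqrt (of_int u))\<bar> \<le> X"
        using abs_Re_le_cmod[of "of_int n - of_int v * csqrt (of_int u)"] by simp
    qed (use sep in auto)
    then have "finite (B p) \<and> real (card (B p)) \<le> real (card Ia) * (2 * X / \<mu> + 1)"
      unfolding B_def p prod.case Ia_def[symmetric] using Ia by (intro card_Sigma_le) auto
    moreover have "real (card Ia) * (2 * X / \<mu> + 1) \<le> (2 * A + 1) * (2 * X / \<mu> + 1)"
      using Ia X \<mu> by (intro mult_right_mono) auto
    ultimately show ?thesis by auto
  qed
  have fin: "finite (W P \<times> W Q)" using W[OF sP] W[OF sQ] by simp
  have *: "finite (Sigma (W P \<times> W Q) B) \<and> real (card (Sigma (W P \<times> W Q) B)) \<le>
      real (card (W P \<times> W Q)) * ((2 * A + 1) * (2 * X / \<mu> + 1))"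
    by (rule card_Sigma_le[OF fin B])
  have sub: "param_box u P Q A X C \<subseteq> Sigma (W P \<times> W Q) B"
    by (auto simp: param_box_def W_def B_def)
  have "real (card (W P \<times> W Q)) \<le> (3 * (P / s)) * (3 * (Q / s))"
    unfolding card_cartesian_product of_nat_mult
    using W[OF sP] W[OF sQ] sP by (intro mult_mono) auto
  also have "\<dots> = 9 * P * Q / \<bar>of_int u\<bar>" unfolding ss[symmetric] using s0 by (simp add: field_simps)
  finally have "real (card (W P \<times> W Q)) * ((2 * A + 1) * (2 * X / \<mu> + 1))
      \<le> 9 * P * Q / \<bar>of_int u\<bar> * ((2 * A + 1) * (2 * X / \<mu> + 1))"
    using A X \<mu> by (intro mult_right_mono) auto
  moreover have "card (param_box u P Q A X C) \<le> card (Sigma (W P \<times> W Q) B)"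
    using * by (intro card_mono sub) auto
  ultimately show ?thesis using * finite_subset[OF sub] by linarith
qed

lemma sum_inverse_le:
  "(\<Sum>u | u \<noteq> 0 \<and> \<bar>u\<bar> \<le> int N. 1 / \<bar>real_of_int u\<bar>) \<le> 2 * harm N"
  "(\<Sum>u | u \<noteq> 0 \<and> \<bar>u\<bar> \<le> int N. 1 / (real_of_int u)\<^sup>2) \<le> 4"
proof -
  have *: "(\<Sum>u | u \<noteq> 0 \<and> \<bar>u\<bar> \<le> int N. g \<bar>u\<bar>) = 2 * (\<Sum>n=1..N. g (int n))" for g :: "int \<Rightarrow> real"
  proof -
    have "{u. u \<noteq> 0 \<and> \<bar>u\<bar> \<le> int N} = int ` {1..N} \<union> (\<lambda>n. - int n) ` {1..N}"
    proof (intro equalityI subsetI)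
      fix u assume u: "u \<in> {u. u \<noteq> 0 \<and> \<bar>u\<bar> \<le> int N}"
      show "u \<in> int ` {1..N} \<union> (\<lambda>n. - int n) ` {1..N}"
      proof (cases "u > 0")
        case True
        then show ?thesis using u by (intro UnI1 image_eqI[of _ _ "nat u"]) auto
      next
        case False
        then show ?thesis using u by (intro UnI2 image_eqI[of _ _ "nat (- u)"]) auto
      qed
    qed auto
    moreover have "int ` {1..N} \<inter> (\<lambda>n. - int n) ` {1..N} = {}" by auto
    ultimately have "(\<Sum>u | u \<noteq> 0 \<and> \<bar>u\<bar> \<le> int N. g \<bar>u\<bar>) =
        (\<Sum>u\<in>int ` {1..N}. g \<bar>u\<bar>) + (\<Sum>u\<in>(\<lambda>n. - int n) ` {1..N}. g \<bar>u\<bar>)"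
      by (simp add: sum.union_disjoint)
    also have "(\<Sum>u\<in>int ` {1..N}. g \<bar>u\<bar>) = (\<Sum>n=1..N. g (int n))"
      by (subst sum.reindex) (auto simp: inj_on_def)
    also have "(\<Sum>u\<in>(\<lambda>n. - int n) ` {1..N}. g \<bar>u\<bar>) = (\<Sum>n=1..N. g (int n))"
      by (subst sum.reindex) (auto simp: inj_on_def)
    finally show ?thesis by simp
  qed
  show "(\<Sum>u | u \<noteq> 0 \<and> \<bar>u\<bar> \<le> int N. 1 / \<bar>real_of_int u\<bar>) \<le> 2 * harm N"
    using *[of "\<lambda>u. 1 / real_of_int u"] by (simp add: harm_def inverse_eq_divide)
  \<comment> \<open>The induction starts with one term: from the empty sum, the convention
    \<open>1 / 0 = 0\<close> would break the telescoping step.\<close>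
  have sq: "(\<Sum>n=1..Suc N. 1 / (real n)\<^sup>2) \<le> 2 - 1 / real (Suc N)" for N
  proof (induction N)
    case (Suc N)
    have "1 / (real (Suc (Suc N)))\<^sup>2 \<le> 1 / real (Suc N) - 1 / real (Suc (Suc N))"
    proof -
      have "1 / (real (Suc (Suc N)))\<^sup>2 \<le> 1 / (real (Suc N) * real (Suc (Suc N)))"
        unfolding power2_eq_square by (intro divide_left_mono mult_right_mono) auto
      also have "\<dots> = 1 / real (Suc N) - 1 / real (Suc (Suc N))" by (simp add: field_simps)
      finally show ?thesis .
    qed
    then show ?case using Suc.IH by (simp only: sum.cl_ivl_Suc) simp
  qed simp
  have "(\<Sum>n=1..N. 1 / (real n)\<^sup>2) \<le> 2"
  proof (cases N)
    case (Suc M)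
    have "0 \<le> 1 / real (Suc M)" by simp
    then show ?thesis using sq[of M] unfolding Suc by linarith
  qed simp
  then show "(\<Sum>u | u \<noteq> 0 \<and> \<bar>u\<bar> \<le> int N. 1 / (real_of_int u)\<^sup>2) \<le> 4"
    using *[of "\<lambda>u. 1 / (real_of_int u)\<^sup>2"] by simp
qed

lemma sum_power_half_le: "finite L \<Longrightarrow> (\<Sum>i\<in>L. 1 / 2 ^ i) \<le> (2 :: real)"
proof -
  assume "finite L"
  then obtain n where "L \<subseteq> {..<n}" by (meson finite_nat_iff_bounded)
  then have "(\<Sum>i\<in>L. 1 / 2 ^ i) \<le> (\<Sum>i<n. (1 / 2 :: real) ^ i)"
    unfolding power_one_over[symmetric] by (intro sum_mono2) auto
  also have "\<dots> \<le> 2" by (subst sum_gp_strict) simp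
  finally show ?thesis .
qed

section \<open>The counting argument\<close>

lemma card_UN_le_sum:
  assumes "finite I" "\<And>i. i \<in> I \<Longrightarrow> finite (B i) \<and> real (card (B i)) \<le> g i"
  shows "finite (\<Union>i\<in>I. B i) \<and> real (card (\<Union>i\<in>I. B i)) \<le> (\<Sum>i\<in>I. g i)"
proof -
  have "real (card (\<Union>i\<in>I. B i)) \<le> real (\<Sum>i\<in>I. card (B i))"
    using card_UN_le[OF assms(1), of B] by (rule of_nat_mono)
  also have "\<dots> \<le> (\<Sum>i\<in>I. g i)" unfolding of_nat_sum using assms by (intro sum_mono) auto
  finally show ?thesis using assms by auto
qed

lemma ex_dyadic:
  fixes t :: real
  assumes "1 \<le> t"
  obtains i :: nat where "2 ^ i \<le> t" "t < 2 * 2 ^ i"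
proof -
  obtain n where n: "t < 2 ^ n" using real_arch_pow[of 2 t] by auto
  define m where "m = (LEAST n. t < 2 ^ n)"
  have m: "t < 2 ^ m" unfolding m_def by (rule LeastI[of _ n]) (rule n)
  have "m \<noteq> 0"
  proof
    assume "m = 0"
    with m show False using assms by simp
  qed
  then obtain i where i: "m = Suc i" by (cases m) auto
  have "\<not> t < 2 ^ i" using not_less_Least[of i "\<lambda>n. t < 2 ^ n"] i by (simp add: m_def)
  then show ?thesis using that[of i] m i by auto
qed

text \<open>The equation results from eliminating \<open>x\<close> between
  \<open>a^2 - 4 * b + 4 * x = 0\<close> and \<open>2 * c = a * x\<close>, which hold when \<theta>
  = 0.\<close>

definition degenerate :: "nat \<Rightarrow> (int \<times> int \<times> int \<times> int) set" where
  "degenerate H = {(a, b, c, d). \<bar>a\<bar> \<le> int H \<and> \<bar>b\<bar> \<le> int H \<and> \<bar>c\<bar> \<le> int H \<and> \<bar>d\<bar> \<le> int H \<and>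
     8 * c = a * (4 * b - a\<^sup>2)}"

text \<open>\<open>a\<close> and \<open>b\<close> determine \<open>c\<close>, while \<open>d\<close>
  is free. For \<open>a \<noteq> 0\<close> the bound on \<open>c\<close> confines \<open>b\<close>
  to an interval of length \<open>4 * H / \<bar>a\<bar>\<close>, and the sum over \<open>a\<close>
  gives the harmonic number; \<open>a = 0\<close> allows every \<open>b\<close>.\<close>

lemma card_degenerate_le:
  "finite (degenerate H) \<and>
    real (card (degenerate H)) \<le> (4 * real H + 1 + 8 * real H * harm H) * (2 * real H + 1)"
proof -
  define I where "I = {- int H..int H}"
  define A where "A = {a::int. a \<noteq> 0 \<and> \<bar>a\<bar> \<le> int H}"
  define B where "B = (\<lambda>a. {b. \<bar>b\<bar> \<le> int H \<and> \<bar>a\<bar> * \<bar>4 * b - a\<^sup>2\<bar> \<le> 8 * int H})"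
  have finB: "finite (B a)" for a
    by (rule finite_subset[of _ I]) (auto simp: B_def I_def)
  have I_eq: "I = insert 0 A" "0 \<notin> A" "finite A"
  proof -
    have "A = I - {0}" by (auto simp: A_def I_def)
    then show "I = insert 0 A" "0 \<notin> A" "finite A" by (auto simp: I_def)
  qed
  have cI: "real (card I) = 2 * real H + 1" by (simp add: I_def)
  have cA: "real (card A) = 2 * real H" using I_eq cI by simp
  have B0: "real (card (B 0)) \<le> 2 * real H + 1"
  proof -
    have "card (B 0) \<le> card I" by (rule card_mono) (auto simp: B_def I_def)
    then show ?thesis using cI by linarith
  qed
  have BA: "real (card (B a)) \<le> 4 * real H * (1 / \<bar>real_of_int a\<bar>) + 1" if "a \<in> A" for a
  proof -
    have a: "\<bar>real_of_int a\<bar> > 0" using that by (simp add: A_def)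
    have "real (card (B a)) \<le> 2 * (2 * real H / \<bar>real_of_int a\<bar>) / 1 + 1"
    proof (rule card_spaced_le[of 1 "2 * real H / \<bar>real_of_int a\<bar>" "B a" "(real_of_int a)\<^sup>2 / 4", THEN conjunct2])
      fix b assume "b \<in> B a"
      then have "\<bar>a\<bar> * \<bar>4 * b - a\<^sup>2\<bar> \<le> 8 * int H" by (simp add: B_def)
      then have "real_of_int (\<bar>a\<bar> * \<bar>4 * b - a\<^sup>2\<bar>) \<le> real_of_int (8 * int H)" by (simp only: of_int_le_iff)
      then have "\<bar>real_of_int a\<bar> * \<bar>4 * real_of_int b - (real_of_int a)\<^sup>2\<bar> \<le> 8 * real H" by simp
      moreover have "\<bar>4 * real_of_int b - (real_of_int a)\<^sup>2\<bar> = 4 * \<bar>real_of_int b - (real_of_int a)\<^sup>2 / 4\<bar>"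
        by (simp add: abs_if)
      ultimately show "\<bar>of_int b - (real_of_int a)\<^sup>2 / 4\<bar> \<le> 2 * real H / \<bar>real_of_int a\<bar>"
        using a by (simp add: field_simps)
    qed (auto simp flip: of_int_diff of_int_abs)
    then show ?thesis by simp
  qed
  have "real (card (Sigma I B)) = (\<Sum>a\<in>I. real (card (B a)))"
    using finB I_eq by (simp add: card_SigmaI)
  also have "\<dots> = real (card (B 0)) + (\<Sum>a\<in>A. real (card (B a)))" using I_eq by simp
  also have "\<dots> \<le> (2 * real H + 1) + (\<Sum>a\<in>A. 4 * real H * (1 / \<bar>real_of_int a\<bar>) + 1)"
    by (intro add_mono B0 sum_mono BA)
  also have "(\<Sum>a\<in>A. 4 * real H * (1 / \<bar>real_of_int a\<bar>) + 1) =
      4 * real H * (\<Sum>a\<in>A. 1 / \<bar>real_of_int a\<bar>) + 2 * real H"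
    unfolding sum.distrib sum_distrib_left using cA by simp
  also have "\<dots> \<le> 4 * real H * (2 * harm H) + 2 * real H"
    using sum_inverse_le(1)[of H] unfolding A_def[symmetric] by (intro add_right_mono mult_left_mono) auto
  finally have S: "real (card (Sigma I B)) \<le> 4 * real H + 1 + 8 * real H * harm H" by simp
  have fin: "finite (Sigma I B \<times> I)" using finB I_eq by auto
  have sub: "degenerate H \<subseteq> (\<lambda>((a, b), d). (a, b, a * (4 * b - a\<^sup>2) div 8, d)) ` (Sigma I B \<times> I)"
  proof
    fix q assume "q \<in> degenerate H"
    then obtain a b c d where q: "q = (a, b, c, d)" "\<bar>a\<bar> \<le> int H" "\<bar>b\<bar> \<le> int H" "\<bar>c\<bar> \<le> int H"
      "\<bar>d\<bar> \<le> int H" "8 * c = a * (4 * b - a\<^sup>2)"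
      by (auto simp: degenerate_def)
    have "\<bar>a\<bar> * \<bar>4 * b - a\<^sup>2\<bar> = 8 * \<bar>c\<bar>" unfolding abs_mult[symmetric] q(6)[symmetric] by (simp add: abs_mult)
    then have "((a, b), d) \<in> Sigma I B \<times> I" using q by (auto simp: I_def B_def)
    moreover have "a * (4 * b - a\<^sup>2) div 8 = c" unfolding q(6)[symmetric] by simp
    ultimately show "q \<in> (\<lambda>((a, b), d). (a, b, a * (4 * b - a\<^sup>2) div 8, d)) ` (Sigma I B \<times> I)"
      using q(1) by (intro image_eqI[of _ _ "((a, b), d)"]) auto
  qed
  have "card (degenerate H) \<le> card (Sigma I B \<times> I)"
    using surj_card_le[OF fin sub] .
  also have "real \<dots> = real (card (Sigma I B)) * (2 * real H + 1)"
    by (simp add: card_cartesian_product cI)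
  also have "\<dots> \<le> (4 * real H + 1 + 8 * real H * harm H) * (2 * real H + 1)"
    by (intro mult_right_mono S) auto
  finally show ?thesis using finite_subset[OF sub finite_imageI[OF fin]] by simp
qed

text \<open>All divisions are exact on the tuples that come from a quartic.\<close>
fun coeff_tuple :: "int \<Rightarrow> (int \<times> int) \<times> int \<times> int \<Rightarrow> int \<times> int \<times> int \<times> int" where
  "coeff_tuple u ((w, v), a, x) =
     (a, (a\<^sup>2 + 4 * x - u * w\<^sup>2) div 4, (a * x + u * v * w) div 2, (x\<^sup>2 - u * v\<^sup>2) div 4)"

text \<open>Outside the degenerate set \<theta> is nonzero, so the parametrization applies, and the
  bounds on the roots place the parameters in the box. The bound on \<open>P\<close> limits
  \<open>u\<close>.\<close>

lemma resolvent_cases: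
  assumes V: "vieta a b c d r1 r2 r3 r4" and x: "r1 * r2 + r3 * r4 \<in> \<int>"
    and H: "\<bar>a\<bar> \<le> int H" "\<bar>b\<bar> \<le> int H" "\<bar>c\<bar> \<le> int H" "\<bar>d\<bar> \<le> int H"
    and nd: "(a, b, c, d) \<notin> degenerate H"
    and bounds: "cmod (r1 + r2 - r3 - r4) \<le> P" "cmod (r1 * r2 - r3 * r4) \<le> Q"
      "2 * cmod (r3 + r4) \<le> A" "2 * cmod (r3 * r4) \<le> X" "P \<le> 12 * real H"
  obtains u w v x where "u \<noteq> 0" "\<bar>u\<bar> \<le> int (144 * H ^ 2)" "coeff_tuple u ((w, v), a, x) = (a, b, c, d)"
    "((w, v), a, x) \<in> param_box u P Q A X (\<lambda>_ _. True)"
    "(r1 - r2) * (r3 - r4) * (r1 + r2 - r3 - r4) \<in> \<int> \<Longrightarrow> u dvd a\<^sup>2 - 8 * x"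
proof -
  obtain X' where X': "r1 * r2 + r3 * r4 = of_int X'" using x by (auto elim: Ints_cases)
  have nz: "r1 + r2 - r3 - r4 \<noteq> 0"
  proof
    assume 0: "r1 + r2 - r3 - r4 = 0"
    note ids = vieta_resolvent_identities[OF V X']
    have "of_int (a\<^sup>2 - 4 * b + 4 * X') = (0 :: complex)" "of_int (2 * c - a * X') = (0 :: complex)"
      using ids(1,3) unfolding 0 by (simp_all del: of_int_diff of_int_add of_int_mult)
    then have e: "a\<^sup>2 - 4 * b + 4 * X' = 0" "2 * c - a * X' = 0" by (simp_all only: of_int_eq_0_iff)
    have "8 * c = a * (4 * X')" using e(2) by simp
    also have "4 * X' = 4 * b - a\<^sup>2" using e(1) by simp
    finally show False using nd H by (simp add: degenerate_def)
  qed
  obtain u w v where uwv: "squarefree u" "w \<noteq> 0"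
    "4 * b = a\<^sup>2 + 4 * X' - u * w\<^sup>2" "4 * d = X'\<^sup>2 - u * v\<^sup>2" "2 * c = a * X' + u * v * w"
    "r1 + r2 - r3 - r4 = of_int w * csqrt (of_int u)"
    "r1 * r2 - r3 * r4 = of_int v * csqrt (of_int u)"
    using resolvent_parametrization[OF V X' nz] by metis
  have u0: "u \<noteq> 0" using uwv(1) by auto
  have a: "of_int a = - (r1 + r2 + r3 + r4)" using V by (simp add: vieta_def)
  show ?thesis
  proof (rule that[of u w v X', OF u0])
    \<comment> \<open>Since \<open>w\<close> is a nonzero integer, the square root of
      \<open>\<bar>u\<bar>\<close> is at most the modulus of \<theta>, hence at most
      \<open>12 * H\<close>.\<close>
    have "1 \<le> \<bar>real_of_int w\<bar>" using uwv(2) by linarith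
    then have "1 * sqrt \<bar>real_of_int u\<bar> \<le> \<bar>of_int w\<bar> * sqrt \<bar>of_int u\<bar>"
      by (intro mult_right_mono) auto
    also have "\<dots> = cmod (of_int w * csqrt (of_int u))" by (simp add: norm_mult norm_csqrt_of_int)
    also have "\<dots> \<le> 12 * real H" using bounds(1,5) unfolding uwv(6) by linarith
    finally have "(sqrt \<bar>real_of_int u\<bar>)\<^sup>2 \<le> (12 * real H)\<^sup>2" by (intro power_mono) auto
    then have "real_of_int \<bar>u\<bar> \<le> real_of_int (int (144 * H ^ 2))" by (simp add: power_mult_distrib)
    then show "\<bar>u\<bar> \<le> int (144 * H ^ 2)" by (simp only: of_int_le_iff)
    show "coeff_tuple u ((w, v), a, X') = (a, b, c, d)"
      by (simp flip: uwv(3-5))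
    have "of_int a + of_int w * csqrt (of_int u) = - (2 * (r3 + r4))"
      unfolding uwv(6)[symmetric] a by (simp add: algebra_simps)
    then have "cmod (of_int a + of_int w * csqrt (of_int u)) = 2 * cmod (r3 + r4)"
      by (simp only: norm_minus_cancel norm_mult) simp
    moreover have "of_int X' - of_int v * csqrt (of_int u) = 2 * (r3 * r4)"
      unfolding uwv(7)[symmetric] X'[symmetric] by (simp add: algebra_simps)
    then have "cmod (of_int X' - of_int v * csqrt (of_int u)) = 2 * cmod (r3 * r4)"
      by (simp only: norm_mult) simp
    ultimately show "((w, v), a, X') \<in> param_box u P Q A X (\<lambda>_ _. True)"
      using uwv(2) bounds unfolding uwv(6,7) by (simp only: param_box_def mem_Collect_eq prod.case) simp
    show "u dvd a\<^sup>2 - 8 * X'" if "(r1 - r2) * (r3 - r4) * (r1 + r2 - r3 - r4) \<in> \<int>"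
      by (rule resolvent_dvd[OF V X' that uwv(1,2,6,7,3)])
  qed
qed

section \<open>Ranges of the parameters and sizes of the boxes\<close>

definition disc_range :: "nat \<Rightarrow> int set" where
  "disc_range H = {u. u \<noteq> 0 \<and> \<bar>u\<bar> \<le> int (144 * H ^ 2)}"

definition dyadic_range :: "nat \<Rightarrow> nat set" where
  "dyadic_range H = {i. 2 ^ i \<le> 3 * real H}"

lemma finite_disc_range: "finite (disc_range H)"
  by (rule finite_subset[of _ "{- int (144 * H ^ 2)..int (144 * H ^ 2)}"]) (auto simp: disc_range_def)

lemma dyadic_range_bound:
  assumes "1 \<le> H"
  shows "finite (dyadic_range H)" "real (card (dyadic_range H)) \<le> log 2 (3 * real H) + 1"
proof -
  define n where "n = nat \<lfloor>log 2 (3 * real H)\<rfloor>"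
  have l0: "0 \<le> log 2 (3 * real H)" using assms by simp
  have sub: "dyadic_range H \<subseteq> {..n}"
  proof
    fix i assume "i \<in> dyadic_range H"
    then have "2 ^ i \<le> 3 * real H" by (simp add: dyadic_range_def)
    then have "real i \<le> log 2 (3 * real H)" using assms by (simp add: le_log_iff powr_realpow)
    then show "i \<in> {..n}" unfolding n_def by (simp add: le_nat_floor)
  qed
  show "finite (dyadic_range H)" using finite_subset[OF sub] by simp
  have "card (dyadic_range H) \<le> Suc n" using card_mono[OF _ sub] by simp
  then show "real (card (dyadic_range H)) \<le> log 2 (3 * real H) + 1"
    using l0 unfolding n_def by linarith
qed

lemma card_image_box_le:
  assumes "finite (param_box u P Q A X C) \<and> real (card (param_box u P Q A X C)) \<le> k" "k \<le> l"
  shows "finite (h ` param_box u P Q A X C) \<and> real (card (h ` param_box u P Q A X C)) \<le> l"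
  using assms card_image_le[of "param_box u P Q A X C" h] by (auto intro: order_trans)

text \<open>Let \<open>t1 \<ge> t2 \<ge> t3 \<ge> t4\<close> be the sizes
  \<open>max 1 \<bar>r\<bar>\<close> of the roots, with \<open>2 ^ i\<close> and
  \<open>2 ^ j\<close> the dyadic sizes of \<open>t3\<close> and \<open>t4\<close>. As the product
  is at most \<open>3 * H\<close>, the bounds dominate \<open>4 * t1\<close>,
  \<open>4 * t1 * t2\<close>, \<open>2 * (t3 + t4)\<close> and \<open>2 * t3 * t4\<close>.\<close>

definition V4_box :: "nat \<Rightarrow> int \<Rightarrow> nat \<Rightarrow> nat \<Rightarrow> ((int \<times> int) \<times> int \<times> int) set" where
  "V4_box H u i j = param_box u (12 * real H / (2 ^ i * 2 ^ i * 2 ^ j)) (12 * real H / (2 ^ i * 2 ^ j))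
     (8 * 2 ^ i) (8 * (2 ^ i * 2 ^ j)) (\<lambda>_ _. True)"

text \<open>Here \<open>2 ^ i\<close> is the dyadic size of the product \<open>t3 * t4\<close>: the
  pairing is prescribed by the generator, so the single roots cannot be ordered.\<close>

definition C4_box :: "nat \<Rightarrow> int \<Rightarrow> nat \<Rightarrow> ((int \<times> int) \<times> int \<times> int) set" where
  "C4_box H u i = param_box u (12 * real H / 2 ^ i) (12 * real H / 2 ^ i)
     (8 * 2 ^ i) (8 * 2 ^ i) (\<lambda>a x. u dvd a\<^sup>2 - 8 * x)"

text \<open>With \<open>D = 2 ^ i\<close> and \<open>E = 2 ^ j\<close>, the pairs
  \<open>w, v\<close> contribute \<open>D^3 * E^2\<close> to the denominator and the pairs
  \<open>a, x\<close> contribute \<open>D^2 * E\<close> to the numerator. The constant is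
  \<open>9 * 12^2 * 17^2\<close>.\<close>

lemma card_V4_box:
  assumes "u \<noteq> 0"
  shows "finite (coeff_tuple u ` V4_box H u i j) \<and> real (card (coeff_tuple u ` V4_box H u i j))
    \<le> 374544 * real H ^ 2 * (1 / \<bar>of_int u\<bar>) * (1 / 2 ^ i) * (1 / 2 ^ j)"
proof -
  define D E :: real where "D = 2 ^ i" and "E = 2 ^ j"
  have D: "1 \<le> D" and E: "1 \<le> E" by (auto simp: D_def E_def)
  have DE: "1 \<le> D * E" using mult_mono[OF D E] D by simp
  have box: "V4_box H u i j = param_box u (12 * real H / (D * D * E)) (12 * real H / (D * E))
      (8 * D) (8 * (D * E)) (\<lambda>_ _. True)"
    by (simp add: V4_box_def D_def E_def)
  have PQ: "12 * real H / (D * D * E) \<le> 12 * real H / (D * E)"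
    using D E by (intro divide_left_mono) (auto simp: mult_le_cancel_right1)
  show ?thesis
    unfolding box D_def[symmetric] E_def[symmetric]
  proof (rule card_image_box_le[OF card_box_le[where \<mu> = 1, OF assms _ PQ]])
    have "9 * (12 * real H / (D * D * E)) * (12 * real H / (D * E)) / \<bar>of_int u\<bar> *
        ((2 * (8 * D) + 1) * (2 * (8 * (D * E)) / 1 + 1))
      \<le> 9 * (12 * real H / (D * D * E)) * (12 * real H / (D * E)) / \<bar>of_int u\<bar> *
        ((17 * D) * (17 * (D * E)))"
      using D E DE by (intro mult_left_mono mult_mono) auto
    also have "\<dots> = 374544 * real H ^ 2 * (1 / \<bar>of_int u\<bar>) * (1 / D) * (1 / E)"
      using D E by (simp add: field_simps power2_eq_square)
    finally show "9 * (12 * real H / (D * D * E)) * (12 * real H / (D * E)) / \<bar>real_of_int u\<bar> *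
        ((2 * (8 * D) + 1) * (2 * (8 * (D * E)) / 1 + 1))
        \<le> 374544 * real H ^ 2 * (1 / \<bar>of_int u\<bar>) * (1 / D) * (1 / E)" .
  qed (use D E in \<open>auto simp flip: of_int_diff of_int_abs\<close>)
qed

text \<open>The powers of \<open>2 ^ i\<close> cancel in the main term, but the congruence spaces
  the values of \<open>x\<close> by \<open>\<bar>u\<bar> / 8\<close> and turns that term into a
  multiple of \<open>1 / u^2\<close>. The \<open>+ 1\<close> in the number of \<open>x\<close>
  leaves a term that decays in \<open>i\<close>. The constants are \<open>9 * 12^2 * 17\<close> and
  \<open>2 * 8 * 8\<close>.\<close>

lemma card_C4_box:
  assumes "u \<noteq> 0"
  shows "finite (coeff_tuple u ` C4_box H u i) \<and> real (card (coeff_tuple u ` C4_box H u i))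
    \<le> 22032 * real H ^ 2 * (128 * (1 / (of_int u)\<^sup>2) + 1 / \<bar>of_int u\<bar> * (1 / 2 ^ i))"
proof -
  define D :: real where "D = 2 ^ i"
  define y where "y = \<bar>real_of_int u\<bar>"
  have D: "1 \<le> D" by (auto simp: D_def)
  have y: "0 < y" using assms by (simp add: y_def)
  have box: "C4_box H u i = param_box u (12 * real H / D) (12 * real H / D)
      (8 * D) (8 * D) (\<lambda>a x. u dvd a\<^sup>2 - 8 * x)"
    by (simp add: C4_box_def D_def)
  have y2: "(real_of_int u)\<^sup>2 = y\<^sup>2" by (simp add: y_def)
  show ?thesis
    unfolding box D_def[symmetric] y_def[symmetric] y2
  proof (rule card_image_box_le[OF card_box_le[where \<mu> = "y / 8", OF assms]])
    fix a x x' assume "u dvd a\<^sup>2 - 8 * x" "u dvd a\<^sup>2 - 8 * x'" "x \<noteq> x'"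
    then have "u dvd (a\<^sup>2 - 8 * x') - (a\<^sup>2 - 8 * x)" by (metis dvd_diff)
    moreover have "(a\<^sup>2 - 8 * x') - (a\<^sup>2 - 8 * x) = 8 * (x - x')" by simp
    ultimately have "u dvd 8 * (x - x')" "8 * (x - x') \<noteq> 0" using \<open>x \<noteq> x'\<close> by auto
    then have "\<bar>u\<bar> \<le> \<bar>8 * (x - x')\<bar>" by (rule dvd_imp_le_int[rotated])
    then have "\<bar>u\<bar> \<le> 8 * \<bar>x - x'\<bar>" unfolding abs_mult by simp
    then have "real_of_int \<bar>u\<bar> \<le> real_of_int (8 * \<bar>x - x'\<bar>)" by (simp only: of_int_le_iff)
    then show "y / 8 \<le> \<bar>of_int (x - x')\<bar>" by (simp add: y_def)
  next
    have "9 * (12 * real H / D) * (12 * real H / D) / \<bar>of_int u\<bar> *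
        ((2 * (8 * D) + 1) * (2 * (8 * D) / (y / 8) + 1))
      \<le> 9 * (12 * real H / D) * (12 * real H / D) / \<bar>of_int u\<bar> *
        ((17 * D) * (2 * (8 * D) / (y / 8) + 1))"
      using D y by (intro mult_left_mono mult_right_mono) auto
    also have "\<dots> = 22032 * real H ^ 2 * (128 * (1 / y\<^sup>2) + 1 / y * (1 / D))"
    proof -
      \<comment> \<open>Naming the reciprocals makes the identity polynomial, with
        \<open>D * k = 1\<close> as the only cancellation.\<close>
      define k z where "k = 1 / D" and "z = 1 / y"
      have Dk: "D * k = 1" using D by (simp add: k_def)
      have "9 * (12 * real H / D) * (12 * real H / D) / y * ((17 * D) * (2 * (8 * D) / (y / 8) + 1)) =
          9 * (12 * real H * k) * (12 * real H * k) * z * ((17 * D) * (128 * D * z + 1))"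
        by (simp add: k_def z_def)
      also have "\<dots> = 22032 * real H ^ 2 * (128 * z\<^sup>2 * (D * k)\<^sup>2 + z * k * (D * k))"
        by (simp add: algebra_simps power2_eq_square)
      also have "\<dots> = 22032 * real H ^ 2 * (128 * z\<^sup>2 + z * k)"
        unfolding Dk by simp
      finally show ?thesis by (simp add: k_def z_def y_def power_divide)
    qed
    finally show "9 * (12 * real H / D) * (12 * real H / D) / \<bar>real_of_int u\<bar> *
        ((2 * (8 * D) + 1) * (2 * (8 * D) / (y / 8) + 1))
        \<le> 22032 * real H ^ 2 * (128 * (1 / y\<^sup>2) + 1 / y * (1 / D))" .
  qed (use D y in auto)
qed

section \<open>Covering both families by boxes\<close>

lemma norm_products:
  fixes r1 r2 r3 r4 :: complex
  defines "t \<equiv> \<lambda>r. max 1 (cmod r)"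
  shows "cmod (r3 + r4) \<le> t r3 + t r4" "cmod (r3 * r4) \<le> t r3 * t r4"
    "cmod (r1 + r2 - r3 - r4) \<le> t r1 + t r2 + t r3 + t r4"
    "cmod (r1 * r2 - r3 * r4) \<le> t r1 * t r2 + t r3 * t r4"
proof -
  have t: "cmod r \<le> t r" for r by (simp add: t_def)
  have m: "cmod (r * r') \<le> t r * t r'" for r r'
    unfolding norm_mult by (intro mult_mono t) (auto simp: t_def)
  show "cmod (r3 + r4) \<le> t r3 + t r4" using norm_triangle_ineq[of r3 r4] t[of r3] t[of r4] by linarith
  show "cmod (r3 * r4) \<le> t r3 * t r4" by (rule m)
  show "cmod (r1 + r2 - r3 - r4) \<le> t r1 + t r2 + t r3 + t r4"
    using norm_triangle_ineq4[of "r1 + r2 - r3" r4] norm_triangle_ineq4[of "r1 + r2" r3]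
      norm_triangle_ineq[of r1 r2] t[of r1] t[of r2] t[of r3] t[of r4] by linarith
  show "cmod (r1 * r2 - r3 * r4) \<le> t r1 * t r2 + t r3 * t r4"
    using norm_triangle_ineq4[of "r1 * r2" "r3 * r4"] m[of r1 r2] m[of r3 r4] by linarith
qed

lemma (in galois_quartic) sorted_roots:
  obtains r1 r2 r3 r4 where "R = {r1, r2, r3, r4}" "distinct [r1, r2, r3, r4]"
    "cmod r2 \<le> cmod r1" "cmod r3 \<le> cmod r2" "cmod r4 \<le> cmod r3"
proof -
  obtain xs where xs: "set xs = R" "distinct xs" using finite_distinct_list[OF finite_R] by auto
  define ys where "ys = sort_key (\<lambda>r. - cmod r) xs"
  have ys: "set ys = R" "distinct ys" "sorted (map (\<lambda>r. - cmod r) ys)"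
    using xs by (auto simp: ys_def)
  have "length ys = 4" using ys card_R distinct_card by metis
  then obtain r1 r2 r3 r4 where "ys = [r1, r2, r3, r4]"
    by (auto simp: numeral_eq_Suc length_Suc_conv)
  with ys show ?thesis by (intro that[of r1 r2 r3 r4]) auto
qed

lemma dyadic_in_range: "2 ^ i \<le> t \<Longrightarrow> t \<le> 3 * real H \<Longrightarrow> i \<in> dyadic_range H"
  by (auto simp: dyadic_range_def)

lemma four_mult_le: "s * y \<le> 3 * h \<Longrightarrow> 0 < y \<Longrightarrow> 4 * s \<le> 12 * h / y" for s y h :: real
  by (subst pos_le_divide_eq) auto

text \<open>Pairing the two largest roots makes the ranges of \<open>w, v, a, x\<close> shrink geometrically in both
  dyadic parameters.\<close>
lemma V4_cover:
  assumes H: "1 \<le> H"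
  shows "{(a, b, c, d) \<in> S_H H. galois_group (quartic a b c d) \<cong> V4} \<subseteq>
    degenerate H \<union> (\<Union>u\<in>disc_range H. \<Union>i\<in>dyadic_range H. \<Union>j\<in>dyadic_range H. coeff_tuple u ` V4_box H u i j)"
proof (clarify, rule ccontr)
  fix a b c d assume abcd: "(a, b, c, d) \<in> S_H H" "galois_group (quartic a b c d) \<cong> V4"
    and nd: "(a, b, c, d) \<notin> degenerate H"
    and no: "(a, b, c, d) \<notin> (\<Union>u\<in>disc_range H. \<Union>i\<in>dyadic_range H. \<Union>j\<in>dyadic_range H.
      coeff_tuple u ` V4_box H u i j)"
  have bd: "\<bar>a\<bar> \<le> int H" "\<bar>b\<bar> \<le> int H" "\<bar>c\<bar> \<le> int H" "\<bar>d\<bar> \<le> int H" using abcd(1) by (auto simp: S_H_def)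
  interpret galois_quartic a b c d by unfold_locales (use abcd in \<open>simp add: S_H_def\<close>)
  obtain r1 r2 r3 r4 where R: "R = {r1, r2, r3, r4}" "distinct [r1, r2, r3, r4]"
    and ord: "cmod r2 \<le> cmod r1" "cmod r3 \<le> cmod r2" "cmod r4 \<le> cmod r3" by (rule sorted_roots)
  \<comment> \<open>Every numbering is admissible here, so the one sorted by absolute value may be
    used.\<close>
  have x: "r1 * r2 + r3 * r4 \<in> \<int>"
  proof (rule V4_resolvent[OF V4_group(1)[OF abcd(2)] _ _ R])
    show "\<sigma> (\<sigma> x) = x" if "\<sigma> \<in> G" "x \<in> K" for \<sigma> x
      using that by (rule V4_group(2)[OF abcd(2)])
    show "\<sigma> (\<tau> x) = \<tau> (\<sigma> x)" if "\<sigma> \<in> G" "\<tau> \<in> G" "x \<in> K" for \<sigma> \<tau> x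
      using that by (rule V4_group(3)[OF abcd(2)])
  qed
  define t where "t = (\<lambda>r. max 1 (cmod r))"
  have t1: "1 \<le> t r" for r by (simp add: t_def)
  have t0: "0 \<le> t r" for r using t1[of r] by linarith
  have to: "t r2 \<le> t r1" "t r3 \<le> t r2" "t r4 \<le> t r3" using ord by (auto simp: t_def)
  have M: "t r1 * t r2 * t r3 * t r4 \<le> 3 * real H"
    unfolding t_def by (rule mahler_bound[OF R bd H])
  obtain i where i: "2 ^ i \<le> t r3" "t r3 < 2 * 2 ^ i" by (rule ex_dyadic[OF t1])
  obtain j where j: "2 ^ j \<le> t r4" "t r4 < 2 * 2 ^ j" by (rule ex_dyadic[OF t1])
  define D E :: real where "D = 2 ^ i" and "E = 2 ^ j"
  have D: "1 \<le> D" and E: "1 \<le> E" by (auto simp: D_def E_def)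
  have i': "D \<le> t r3" "t r3 \<le> 2 * D" using i by (auto simp: D_def)
  have j': "E \<le> t r4" "t r4 \<le> 2 * E" using j by (auto simp: E_def)
  \<comment> \<open>The second factor \<open>D\<close> comes from
    \<open>t r2 \<ge> t r3 \<ge> D\<close>.\<close>
  have M1: "t r1 * (D * D * E) \<le> 3 * real H"
  proof -
    have "t r1 * (D * D * E) \<le> t r1 * (t r2 * t r3 * t r4)"
      using i' j' to D E t0 by (intro mult_left_mono mult_mono) auto
    then show ?thesis using M by (simp add: mult.assoc)
  qed
  have M2: "t r1 * t r2 * (D * E) \<le> 3 * real H"
  proof -
    have "t r1 * t r2 * (D * E) \<le> t r1 * t r2 * (t r3 * t r4)"
      using i' j' D E t0 by (intro mult_left_mono mult_mono mult_nonneg_nonneg) auto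
    then show ?thesis using M by (simp add: mult.assoc)
  qed
  have r12: "t r3 * t r4 \<le> t r1 * t r2" using to t0 by (intro mult_mono) auto
  have P: "cmod (r1 + r2 - r3 - r4) \<le> 12 * real H / (D * D * E)"
  proof -
    have "cmod (r1 + r2 - r3 - r4) \<le> 4 * t r1"
      using norm_products(3)[of r1 r2 r3 r4] to unfolding t_def[symmetric] by (simp add: t_def)
    also have "\<dots> \<le> 12 * real H / (D * D * E)"
      using M1 D E by (intro four_mult_le) auto
    finally show ?thesis .
  qed
  have Q: "cmod (r1 * r2 - r3 * r4) \<le> 12 * real H / (D * E)"
  proof -
    have "cmod (r1 * r2 - r3 * r4) \<le> 4 * (t r1 * t r2)"
      using norm_products(4)[of r1 r2 r3 r4] r12 t0[of r1] t0[of r2] mult_nonneg_nonneg[OF t0 t0, of r1 r2]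
      unfolding t_def by linarith
    also have "\<dots> \<le> 12 * real H / (D * E)"
      using M2 D E by (intro four_mult_le) auto
    finally show ?thesis .
  qed
  have A: "2 * cmod (r3 + r4) \<le> 8 * D"
    using norm_products(1)[of r3 r4] to(3) i'(2) unfolding t_def by linarith
  have X: "2 * cmod (r3 * r4) \<le> 8 * (D * E)"
  proof -
    have "t r3 * t r4 \<le> (2 * D) * (2 * E)" using i' j' t0 D by (intro mult_mono) auto
    then show ?thesis using norm_products(2)[of r3 r4] unfolding t_def by linarith
  qed
  have PH: "12 * real H / (D * D * E) \<le> 12 * real H"
  proof -
    have "1 * 1 * 1 \<le> D * D * E" using D E by (intro mult_mono) auto
    then show ?thesis by (simp add: divide_le_eq mult_le_cancel_left1)
  qed
  obtain u w v x where "u \<noteq> 0" "\<bar>u\<bar> \<le> int (144 * H ^ 2)" "coeff_tuple u ((w, v), a, x) = (a, b, c, d)"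
    "((w, v), a, x) \<in> param_box u (12 * real H / (D * D * E)) (12 * real H / (D * E)) (8 * D) (8 * (D * E)) (\<lambda>_ _. True)"
    using resolvent_cases[OF vieta_roots[OF R] x bd nd P Q A X PH] by metis
  then have "u \<in> disc_range H" "(a, b, c, d) \<in> coeff_tuple u ` V4_box H u i j"
    by (auto simp: disc_range_def V4_box_def D_def E_def intro!: image_eqI[of _ _ "((w, v), a, x)"])
  moreover have "t r3 \<le> 3 * real H" "t r4 \<le> 3 * real H"
  proof -
    have "1 * 1 * t r3 * 1 \<le> t r1 * t r2 * t r3 * t r4"
      using t1 t0 by (intro mult_mono mult_nonneg_nonneg) auto
    then show "t r3 \<le> 3 * real H" using M by simp
    then show "t r4 \<le> 3 * real H" using to by simp
  qed
  then have "i \<in> dyadic_range H" "j \<in> dyadic_range H" using i j by (auto intro: dyadic_in_range)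
  ultimately show False using no by blast
qed

text \<open>Exchanging the two pairs preserves the resolvent root and negates the other integer, so
  the pair with the larger product may be put first.\<close>

lemma (in galois_quartic) C4_roots_ordered:
  assumes "galois_group f \<cong> C4"
  obtains r1 r2 r3 r4 where "R = {r1, r2, r3, r4}" "distinct [r1, r2, r3, r4]"
    "r1 * r2 + r3 * r4 \<in> \<int>"
    "(r1 - r2) * (r3 - r4) * (r1 + r2 - r3 - r4) \<in> \<int>"
    "max 1 (cmod r3) * max 1 (cmod r4) \<le> max 1 (cmod r1) * max 1 (cmod r2)"
proof -
  obtain \<sigma> where \<sigma>: "\<sigma> \<in> G" "card G = 4"
    "G \<subseteq> {restrict id K, \<sigma>, compose K \<sigma> \<sigma>, compose K \<sigma> (compose K \<sigma> \<sigma>)}"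
    "\<And>x. x \<in> K \<Longrightarrow> \<sigma> (\<sigma> (\<sigma> (\<sigma> x))) = x"
    using C4_group[OF assms] by blast
  obtain r1 r2 r3 r4 where r: "R = {r1, r2, r3, r4}" "distinct [r1, r2, r3, r4]"
    "r1 * r2 + r3 * r4 \<in> \<int>" "(r1 - r2) * (r3 - r4) * (r1 + r2 - r3 - r4) \<in> \<int>"
    using C4_resolvent[OF \<sigma>] by blast
  show ?thesis
  proof (cases "max 1 (cmod r3) * max 1 (cmod r4) \<le> max 1 (cmod r1) * max 1 (cmod r2)")
    case True
    then show ?thesis using that[OF r] by blast
  next
    case False
    have "(r3 - r4) * (r1 - r2) * (r3 + r4 - r1 - r2) = - ((r1 - r2) * (r3 - r4) * (r1 + r2 - r3 - r4))"
      by (simp add: algebra_simps)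
    also have "\<dots> \<in> \<int>" using r(4) by (rule Ints_minus)
    finally have "(r3 - r4) * (r1 - r2) * (r3 + r4 - r1 - r2) \<in> \<int>" .
    moreover have "R = {r3, r4, r1, r2}" "distinct [r3, r4, r1, r2]" "r3 * r4 + r1 * r2 \<in> \<int>"
      using r(1-3) by (auto simp: add.commute)
    ultimately show ?thesis using that[of r3 r4 r1 r2] False by linarith
  qed
qed

text \<open>Only the products \<open>T\<close> and \<open>S\<close> over the two pairs are compared.
  Sums within a pair are bounded through \<open>p + q \<le> 2 * (p * q)\<close> for
  \<open>p, q \<ge> 1\<close>, and \<open>S\<close> is the only quantity split dyadically.\<close>

lemma C4_cover:
  assumes H: "1 \<le> H"
  shows "{(a, b, c, d) \<in> S_H H. galois_group (quartic a b c d) \<cong> C4} \<subseteq>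
    degenerate H \<union> (\<Union>u\<in>disc_range H. \<Union>i\<in>dyadic_range H. coeff_tuple u ` C4_box H u i)"
proof (clarify, rule ccontr)
  fix a b c d assume abcd: "(a, b, c, d) \<in> S_H H" "galois_group (quartic a b c d) \<cong> C4"
    and nd: "(a, b, c, d) \<notin> degenerate H"
    and no: "(a, b, c, d) \<notin> (\<Union>u\<in>disc_range H. \<Union>i\<in>dyadic_range H. coeff_tuple u ` C4_box H u i)"
  have bd: "\<bar>a\<bar> \<le> int H" "\<bar>b\<bar> \<le> int H" "\<bar>c\<bar> \<le> int H" "\<bar>d\<bar> \<le> int H" using abcd(1) by (auto simp: S_H_def)
  interpret galois_quartic a b c d by unfold_locales (use abcd in \<open>simp add: S_H_def\<close>)
  obtain r1 r2 r3 r4 where R: "R = {r1, r2, r3, r4}" "distinct [r1, r2, r3, r4]"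
    and x: "r1 * r2 + r3 * r4 \<in> \<int>" and y: "(r1 - r2) * (r3 - r4) * (r1 + r2 - r3 - r4) \<in> \<int>"
    and ord: "max 1 (cmod r3) * max 1 (cmod r4) \<le> max 1 (cmod r1) * max 1 (cmod r2)"
    by (rule C4_roots_ordered[OF abcd(2)])
  define t where "t = (\<lambda>r. max 1 (cmod r))"
  have t1: "1 \<le> t r" for r by (simp add: t_def)
  have t0: "0 \<le> t r" for r using t1[of r] by linarith
  have ab: "p + q \<le> 2 * (p * q)" if "1 \<le> p" "1 \<le> q" for p q :: real
  proof -
    have "p * 1 \<le> p * q" "1 * q \<le> p * q" using that by (intro mult_mono; simp)+
    then show ?thesis by linarith
  qed
  define T S where "T = t r1 * t r2" and "S = t r3 * t r4"
  have TS: "S \<le> T" using ord by (simp add: T_def S_def t_def)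
  have S1: "1 \<le> S" unfolding S_def using mult_mono[OF t1[of r3] t1[of r4]] t0 by simp
  have M: "T * S \<le> 3 * real H"
    using mahler_bound[OF R bd H] by (simp add: T_def S_def t_def mult.assoc)
  obtain i where i: "2 ^ i \<le> S" "S < 2 * 2 ^ i" by (rule ex_dyadic[OF S1])
  define D :: real where "D = 2 ^ i"
  have D: "1 \<le> D" by (simp add: D_def)
  have i': "D \<le> S" "S \<le> 2 * D" using i by (auto simp: D_def)
  have "T * D \<le> T * S" using i' TS S1 by (intro mult_left_mono) auto
  then have "T * D \<le> 3 * real H" using M by linarith
  then have T: "4 * T \<le> 12 * real H / D" using D by (intro four_mult_le) auto
  have sums: "t r1 + t r2 \<le> 2 * T" "t r3 + t r4 \<le> 2 * S"
    unfolding T_def S_def by (intro ab t1)+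
  have P: "cmod (r1 + r2 - r3 - r4) \<le> 12 * real H / D"
    using norm_products(3)[of r1 r2 r3 r4] sums TS T unfolding t_def by linarith
  have Q: "cmod (r1 * r2 - r3 * r4) \<le> 12 * real H / D"
    using norm_products(4)[of r1 r2 r3 r4] TS T S1 unfolding T_def S_def t_def by linarith
  have A: "2 * cmod (r3 + r4) \<le> 8 * D"
    using norm_products(1)[of r3 r4] sums i' unfolding t_def by linarith
  have X: "2 * cmod (r3 * r4) \<le> 8 * D"
    using norm_products(2)[of r3 r4] i' D unfolding S_def t_def by linarith
  have PH: "12 * real H / D \<le> 12 * real H"
    using D by (simp add: divide_le_eq mult_le_cancel_left1)
  obtain u w v x where "u \<noteq> 0" "\<bar>u\<bar> \<le> int (144 * H ^ 2)" "coeff_tuple u ((w, v), a, x) = (a, b, c, d)"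
    "((w, v), a, x) \<in> param_box u (12 * real H / D) (12 * real H / D) (8 * D) (8 * D) (\<lambda>_ _. True)"
    "u dvd a\<^sup>2 - 8 * x"
    using resolvent_cases[OF vieta_roots[OF R] x bd nd P Q A X PH] y by metis
  then have "u \<in> disc_range H" "(a, b, c, d) \<in> coeff_tuple u ` C4_box H u i"
    by (auto simp: disc_range_def C4_box_def param_box_def D_def intro!: image_eqI[of _ _ "((w, v), a, x)"])
  moreover have "S \<le> 3 * real H"
  proof -
    have "1 * S \<le> T * S" using TS S1 by (intro mult_right_mono) auto
    then show ?thesis using M by simp
  qed
  then have "i \<in> dyadic_range H" using i by (auto intro: dyadic_in_range)
  ultimately show False using no by blast
qed

section \<open>Summation over the boxes and the final estimate\<close>

lemma card_V4_le:
  assumes H: "1 \<le> H"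
  shows "real (N_G V4 H) \<le> (4 * real H + 1 + 8 * real H * harm H) * (2 * real H + 1) +
    2996352 * real H ^ 2 * harm (144 * H ^ 2)"
proof -
  define g where "g = (\<lambda>u i j. 374544 * real H ^ 2 * (1 / \<bar>real_of_int u\<bar>) * (1 / 2 ^ i) * (1 / 2 ^ j))"
  let ?U = "disc_range H" and ?L = "dyadic_range H"
  let ?B = "\<Union>u\<in>?U. \<Union>i\<in>?L. \<Union>j\<in>?L. coeff_tuple u ` V4_box H u i j"
  have u0: "u \<noteq> 0" if "u \<in> ?U" for u using that by (simp add: disc_range_def)
  have B: "finite ?B \<and> real (card ?B) \<le> (\<Sum>u\<in>?U. \<Sum>i\<in>?L. \<Sum>j\<in>?L. g u i j)"
    unfolding g_def
    by (intro card_UN_le_sum finite_disc_range dyadic_range_bound(1)[OF H] card_V4_box u0)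
  have half: "(\<Sum>i\<in>?L. 1 / 2 ^ i) \<le> (2 :: real)" by (rule sum_power_half_le[OF dyadic_range_bound(1)[OF H]])
  \<comment> \<open>The triple sum factors. Both dyadic sums are geometric and at most 2, so only
    the sum over \<open>u\<close> is logarithmic.\<close>
  have "(\<Sum>u\<in>?U. \<Sum>i\<in>?L. \<Sum>j\<in>?L. g u i j) =
      374544 * real H ^ 2 * (\<Sum>u\<in>?U. 1 / \<bar>real_of_int u\<bar>) * (\<Sum>i\<in>?L. 1 / 2 ^ i) * (\<Sum>j\<in>?L. 1 / 2 ^ j)"
    unfolding g_def by (simp only: sum_distrib_left[symmetric] sum_distrib_right[symmetric])
  also have "\<dots> \<le> 374544 * real H ^ 2 * (2 * harm (144 * H ^ 2)) * 2 * 2"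
    using sum_inverse_le(1)[of "144 * H ^ 2"] half unfolding disc_range_def[symmetric]
    by (intro mult_mono mult_nonneg_nonneg sum_nonneg) (auto simp: harm_nonneg)
  also have "\<dots> = 2996352 * real H ^ 2 * harm (144 * H ^ 2)" by simp
  finally have "real (card ?B) \<le> 2996352 * real H ^ 2 * harm (144 * H ^ 2)" using B by linarith
  moreover have "N_G V4 H \<le> card (degenerate H \<union> ?B)"
    unfolding N_G_def by (rule card_mono[OF _ V4_cover[OF H]]) (use B card_degenerate_le in auto)
  moreover have "card (degenerate H \<union> ?B) \<le> card (degenerate H) + card ?B" by (rule card_Un_le)
  ultimately show ?thesis using card_degenerate_le[of H] by linarith
qed

lemma card_C4_le:
  assumes H: "1 \<le> H"
  shows "real (N_G C4 H) \<le> (4 * real H + 1 + 8 * real H * harm H) * (2 * real H + 1) +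
    22032 * real H ^ 2 * (512 * (log 2 (3 * real H) + 1) + 4 * harm (144 * H ^ 2))"
proof -
  define g where "g = (\<lambda>u i. 22032 * real H ^ 2 * (128 * (1 / (real_of_int u)\<^sup>2) + 1 / \<bar>of_int u\<bar> * (1 / 2 ^ i)))"
  let ?U = "disc_range H" and ?L = "dyadic_range H"
  let ?B = "\<Union>u\<in>?U. \<Union>i\<in>?L. coeff_tuple u ` C4_box H u i"
  have u0: "u \<noteq> 0" if "u \<in> ?U" for u using that by (simp add: disc_range_def)
  have B: "finite ?B \<and> real (card ?B) \<le> (\<Sum>u\<in>?U. \<Sum>i\<in>?L. g u i)"
    unfolding g_def
    by (intro card_UN_le_sum finite_disc_range dyadic_range_bound(1)[OF H] card_C4_box u0)
  have half: "(\<Sum>i\<in>?L. 1 / 2 ^ i) \<le> (2 :: real)" by (rule sum_power_half_le[OF dyadic_range_bound(1)[OF H]])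
  \<comment> \<open>The \<open>1 / u^2\<close> part has a bounded sum over \<open>u\<close> and
    costs the number of dyadic scales; the other part is harmonic in \<open>u\<close> and geometric
    in \<open>i\<close>. Each yields a single logarithm.\<close>
  have "(\<Sum>u\<in>?U. \<Sum>i\<in>?L. g u i) =
      22032 * real H ^ 2 * (real (card ?L) * (128 * (\<Sum>u\<in>?U. 1 / (real_of_int u)\<^sup>2)) +
        (\<Sum>u\<in>?U. 1 / \<bar>real_of_int u\<bar>) * (\<Sum>i\<in>?L. 1 / 2 ^ i))"
    unfolding g_def by (simp only: sum_distrib_left[symmetric] sum_distrib_right[symmetric] sum.distrib sum_constant) simp
  also have "\<dots> \<le> 22032 * real H ^ 2 * ((log 2 (3 * real H) + 1) * (128 * 4) + (2 * harm (144 * H ^ 2)) * 2)"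
    using sum_inverse_le[of "144 * H ^ 2"] half dyadic_range_bound(2)[OF H] H
    unfolding disc_range_def[symmetric]
    by (intro mult_left_mono add_mono mult_mono mult_nonneg_nonneg sum_nonneg) (auto simp: harm_nonneg)
  also have "\<dots> = 22032 * real H ^ 2 * (512 * (log 2 (3 * real H) + 1) + 4 * harm (144 * H ^ 2))" by simp
  finally have "real (card ?B) \<le> 22032 * real H ^ 2 * (512 * (log 2 (3 * real H) + 1) + 4 * harm (144 * H ^ 2))"
    using B by linarith
  moreover have "N_G C4 H \<le> card (degenerate H \<union> ?B)"
    unfolding N_G_def by (rule card_mono[OF _ C4_cover[OF H]]) (use B card_degenerate_le in auto)
  moreover have "card (degenerate H \<union> ?B) \<le> card (degenerate H) + card ?B" by (rule card_Un_le)
  ultimately show ?thesis using card_degenerate_le[of H] by linarith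
qed

theorem theorem1p6:
  shows "(\<lambda>H::nat. real (N_G V4 H + N_G C4 H)) \<in> O(\<lambda>H. real H ^ 2 * ln (real H))"
proof -
  \<comment> \<open>The factor 2 counts the degenerate tuples once for each of the two
    groups.\<close>
  define B where "B = (\<lambda>H. 2 * ((4 * real H + 1 + 8 * real H * (ln (real H) + 1)) * (2 * real H + 1)) +
    2996352 * real H ^ 2 * (ln (144 * real H ^ 2) + 1) +
    22032 * real H ^ 2 * (512 * (log 2 (3 * real H) + 1) + 4 * (ln (144 * real H ^ 2) + 1)))"
  have bound: "norm (real (N_G V4 H + N_G C4 H)) \<le> norm (B H)" if H: "1 \<le> H" for H
  proof -
    \<comment> \<open>The difference \<open>harm n - ln n\<close> decreases from its value 1 at
      \<open>n = 1\<close>.\<close>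
    have h: "harm H \<le> ln (real H) + 1" "harm (144 * H ^ 2) \<le> ln (144 * real H ^ 2) + 1"
      using euler_mascheroni_sequence_decreasing[of 1 H] euler_mascheroni_sequence_decreasing[of 1 "144 * H ^ 2"] H by (auto simp: harm_def)
    have "(4 * real H + 1 + 8 * real H * harm H) * (2 * real H + 1) \<le>
        (4 * real H + 1 + 8 * real H * (ln (real H) + 1)) * (2 * real H + 1)"
      using h by (intro mult_right_mono add_left_mono mult_left_mono) auto
    moreover have "2996352 * real H ^ 2 * harm (144 * H ^ 2) \<le> 2996352 * real H ^ 2 * (ln (144 * real H ^ 2) + 1)"
      using h by (intro mult_left_mono) auto
    moreover have "22032 * real H ^ 2 * (512 * (log 2 (3 * real H) + 1) + 4 * harm (144 * H ^ 2)) \<le>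
        22032 * real H ^ 2 * (512 * (log 2 (3 * real H) + 1) + 4 * (ln (144 * real H ^ 2) + 1))"
      using h by (intro mult_left_mono add_left_mono) auto
    ultimately have "real (N_G V4 H + N_G C4 H) \<le> B H"
      using card_V4_le[OF H] card_C4_le[OF H] unfolding B_def by linarith
    then show ?thesis unfolding real_norm_def by linarith
  qed
  have "eventually (\<lambda>H. norm (real (N_G V4 H + N_G C4 H)) \<le> norm (B H)) sequentially"
    by (intro eventually_sequentiallyI[of 1] bound)
  then have "(\<lambda>H. real (N_G V4 H + N_G C4 H)) \<in> O(B)" by (rule landau_o.big_mono)
  also have "B \<in> O(\<lambda>H. real H ^ 2 * ln (real H))"
    unfolding B_def log_def by real_asymp
  finally show ?thesis .
qed

end
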